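(* Let $p_1,p_2,p_3,p_4$ be integers with $4\le p_1\le p_2$, $p_3-p_2\ge p_1$ and $p_4-p_3\ge p_1$, and let $n>3(p_1-2)+\sum_{i=2}^4 p_i(p_i+1)$. Then $$sat(n,K_{p_1}\cup K_{p_2}\cup K_{p_3}\cup K_{p_4})=e(H(n;p_1,p_2,p_3,p_4))=(p_1-2)(n-p_1+2)+\sum_{i=2}^4\binom{p_i+1}{2},$$ and $H(n;p_1,p_2,p_3,p_4)$ is an extremal graph, i.e., it is an $n$-vertex $K_{p_1}\cup K_{p_2}\cup K_{p_3}\cup K_{p_4}$-saturated graph with exactly $sat(n,K_{p_1}\cup K_{p_2}\cup K_{p_3}\cup K_{p_4})$ edges.
   Context: All graphs are finite and simple; $e(G)$ is the number of edges of $G$. $K_m$ denotes the complete graph and $I_m$ the edgeless graph on $m$ vertices. For vertex-disjoint graphs $G,H$, $G\cup H$ is their disjoint union and $G\lor H$ is the join (add all edges between $V(G)$ and $V(H)$). $H(n;p_1,\dots,p_t)$ denotes the $n$-vertex graph $K_{p_1-2}\lor\bigl(K_{p_2+1}\cup\dots\cup K_{p_t+1}\cup I_{n-t+3-\sum_{i=1}^t p_i}\bigr)$. A graph $G$ is $F$-saturated if $G$ contains no subgraph isomorphic to $F$ but for every pair of nonadjacent vertices $u,v$, $G+uv$ contains a subgraph isomorphic to $F$. The saturation number $sat(n,F)$ is the minimum number of edges of an $F$-saturated graph on $n$ vertices. $K_{p_1}\cup\dots\cup K_{p_4}$ denotes the vertex-disjoint union of cliques of orders $p_1,\dots,p_4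$.
   Formalization: The displayed closed formula omits the edges inside K_{p_1-2} and so is not e(H) for any p_1≥4; the formal statement adds the missing term binom(p_1-2,2) to the formula and is otherwise as stated. *)

theory Defs
  imports Complex_Main
begin

datatype 'a graph = Graph (verts: "'a set") (edges: "'a set set")

definition simple_graph :: "'a graph \<Rightarrow> bool" where
  "simple_graph G \<longleftrightarrow>
     finite (verts G) \<and> (\<forall>e \<in> edges G. e \<subseteq> verts G \<and> card e = 2)"

definition num_edges :: "'a graph \<Rightarrow> nat" where
  "num_edges G = card (edges G)"

definition complete_graph :: "nat \<Rightarrow> nat graph" where
  "complete_graph m = Graph {..<m} {e. e \<subseteq> {..<m} \<and> card e = 2}"

definition edgeless_graph :: "nat \<Rightarrow> nat graph" where
  "edgeless_graph m = Graph {..<m} {}"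

text \<open>Vertex-disjointness is enforced by tagging: the vertices of the \<open>i\<close>-th graph of the
  list are paired with \<open>i\<close>, and in a join the two sides are tagged by \<open>Inl\<close> and \<open>Inr\<close>.\<close>

definition disjoint_union :: "'a graph list \<Rightarrow> (nat \<times> 'a) graph" where
  "disjoint_union Gs = Graph
     (\<Union>i<length Gs. Pair i ` verts (Gs ! i))
     (\<Union>i<length Gs. (`) (Pair i) ` edges (Gs ! i))"

definition graph_join :: "'a graph \<Rightarrow> 'b graph \<Rightarrow> ('a + 'b) graph" where
  "graph_join G H = Graph
     (Inl ` verts G \<union> Inr ` verts H)
     ((`) Inl ` edges G \<union> (`) Inr ` edges H
       \<union> {{Inl u, Inr v} |u v. u \<in> verts G \<and> v \<in> verts H})"

definition clique_union :: "nat list \<Rightarrow> (nat \<times> nat) graph" where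
  "clique_union ps = disjoint_union (map complete_graph ps)"

text \<open>The graph \<open>H(n; p\<^sub>1, \<dots>, p\<^sub>t)\<close> for \<open>ps = [p\<^sub>1, \<dots>, p\<^sub>t]\<close>.  The order
  \<open>n - t + 3 - \<Sum> p\<^sub>i\<close> of the edgeless part is written so that natural-number
  subtraction truncates only if that integer is negative.\<close>

definition H_graph :: "nat \<Rightarrow> nat list \<Rightarrow> (nat + nat \<times> nat) graph" where
  "H_graph n ps = graph_join
     (complete_graph (hd ps - 2))
     (disjoint_union
        (map (\<lambda>p. complete_graph (p + 1)) (tl ps)
          @ [edgeless_graph (n + 3 - (length ps + sum_list ps))]))"

definition subgraph :: "'a graph \<Rightarrow> 'a graph \<Rightarrow> bool" where
  "subgraph S G \<longleftrightarrow> simple_graph S \<and> verts S \<subseteq> verts G \<and> edges S \<subseteq> edges G"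

definition isomorphic :: "'a graph \<Rightarrow> 'b graph \<Rightarrow> bool" where
  "isomorphic G H \<longleftrightarrow>
     (\<exists>f. bij_betw f (verts G) (verts H) \<and> (`) f ` edges G = edges H)"

definition contains_copy :: "'a graph \<Rightarrow> 'b graph \<Rightarrow> bool" where
  "contains_copy G F \<longleftrightarrow> (\<exists>S. subgraph S G \<and> isomorphic S F)"

definition add_edge :: "'a graph \<Rightarrow> 'a \<Rightarrow> 'a \<Rightarrow> 'a graph" where
  "add_edge G u v = Graph (verts G) (insert {u, v} (edges G))"

definition saturated :: "'b graph \<Rightarrow> 'a graph \<Rightarrow> bool" where
  "saturated F G \<longleftrightarrow>
     simple_graph G \<and> \<not> contains_copy G F \<and>
     (\<forall>u \<in> verts G. \<forall>v \<in> verts G.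
        u \<noteq> v \<and> {u, v} \<notin> edges G \<longrightarrow> contains_copy (add_edge G u v) F)"

text \<open>Every finite graph has an isomorphic copy with natural numbers as vertices, so the minimum
  over graphs on natural numbers is the minimum over all \<open>n\<close>-vertex graphs.\<close>

definition sat :: "nat \<Rightarrow> 'b graph \<Rightarrow> nat" where
  "sat n F = (LEAST m. \<exists>G :: nat graph.
     card (verts G) = n \<and> saturated F G \<and> num_edges G = m)"

definition extremal_graph :: "nat \<Rightarrow> 'b graph \<Rightarrow> 'a graph \<Rightarrow> bool" where
  "extremal_graph n F G \<longleftrightarrow>
     card (verts G) = n \<and> saturated F G \<and> num_edges G = sat n F"

end

theory Submission
  imports Defs "HOL-Library.Disjoint_Sets"
begin

text \<open>Let \<open>a = p\<^sub>1 - 2\<close>.  In a saturated graph two nonadjacent vertices have at least \<open>a\<close> common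
  neighbours which span a clique.  If the minimum degree \<open>d\<close> exceeds \<open>a\<close>, degree counting around a
  vertex of minimum degree already gives enough edges.  If \<open>d = a\<close>, the neighbourhood \<open>C\<close> of a vertex
  of degree \<open>a\<close> is a clique joined to everything else, and adding an edge at that vertex shows that
  outside \<open>C\<close>, for every vertex \<open>w\<close>, there are disjoint cliques of orders \<open>p\<^sub>2, p\<^sub>3, p\<^sub>4\<close>
  avoiding \<open>w\<close>.  This alone forces \<open>\<Sum> (p\<^sub>i + 1 choose 2)\<close> edges outside \<open>C\<close>: compare
  two such triples.  If their largest cliques differ in at least two vertices, the crossing edges
  suffice because of the gaps between the \<open>p\<^sub>i\<close>.  Otherwise all largest cliques lie in one clique of
  order \<open>p\<^sub>4 + 1\<close>, no edge of which is used by the smaller cliques, so it can be removed.\<close>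

section \<open>Clique systems avoiding a vertex\<close>

definition pairs :: "'a set \<Rightarrow> 'a set set" where
  "pairs K = {e. e \<subseteq> K \<and> card e = 2}"

text \<open>For disjoint sets this is the edge set of a complete bipartite graph; a common element
  would contribute a singleton.\<close>

definition between :: "'a set \<Rightarrow> 'a set \<Rightarrow> 'a set set" where
  "between A B = (\<lambda>(x, y). {x, y}) ` (A \<times> B)"

lemma finite_pairs [simp]: "finite K \<Longrightarrow> finite (pairs K)"
  by (simp add: pairs_def)

lemma card_pairs: "finite K \<Longrightarrow> card (pairs K) = card K choose 2"
  unfolding pairs_def by (rule n_subsets)

lemma pairs_mono: "A \<subseteq> B \<Longrightarrow> pairs A \<subseteq> pairs B"
  by (auto simp: pairs_def)

lemma pair_in_pairs [simp]: "{x, y} \<in> pairs K \<longleftrightarrow> x \<in> K \<and> y \<in> K \<and> x \<noteq> y"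
  by (auto simp: pairs_def card_2_iff doubleton_eq_iff)

lemma pairsE:
  assumes "e \<in> pairs K"
  obtains x y where "e = {x, y}" "x \<in> K" "y \<in> K" "x \<noteq> y"
  using assms by (auto simp: pairs_def card_2_iff)

lemma pairs_disjoint:
  assumes "finite A" "card (A \<inter> B) \<le> 1"
  shows "pairs A \<inter> pairs B = {}"
proof -
  have "card e \<noteq> 2" if "e \<subseteq> A" "e \<subseteq> B" for e
    using card_mono[of "A \<inter> B" e] that assms by simp
  then show ?thesis by (auto simp: pairs_def)
qed

lemma card_between:
  assumes "finite A" "finite B" "A \<inter> B = {}"
  shows "card (between A B) = card A * card B"
proof -
  have "inj_on (\<lambda>(x, y). {x, y}) (A \<times> B)"
    using assms(3) by (auto simp: inj_on_def doubleton_eq_iff)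
  then show ?thesis by (simp add: between_def card_image card_cartesian_product)
qed

lemma choose_two_Suc: "(m + 1) choose 2 = (m choose 2) + m" for m :: nat
  by (simp add: numeral_2_eq_2)

text \<open>Split \<open>K\<close> into \<open>A\<close> and \<open>K - A\<close>, each with at
  least \<open>a\<close> vertices, so that no block contains a vertex of both. All edges across are
  then uncovered, and their number is least when one side has exactly \<open>a\<close> vertices.
  \<open>A\<close> is the trace of a block with at least \<open>a\<close> vertices in
  \<open>K\<close>, or else \<open>a\<close> vertices outside all blocks.\<close>

lemma crossing_pairs:
  assumes fin: "finite K" "finite \<B>" and dis: "pairwise disjnt \<B>"
    and small: "\<And>B. B \<in> \<B> \<Longrightarrow> card (K \<inter> B) + a \<le> card K"
    and big: "2 * a \<le> card K" "(a - 1) * (card \<B> + 1) < card K"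
  shows "a * (card K - a) \<le> card (pairs K - (\<Union>B\<in>\<B>. pairs B))"
proof -
  obtain A where A: "A \<subseteq> K" "a \<le> card A" "card A + a \<le> card K"
    and cr: "\<And>x y B. x \<in> A \<Longrightarrow> y \<in> K - A \<Longrightarrow> B \<in> \<B> \<Longrightarrow> x \<in> B \<Longrightarrow> y \<in> B \<Longrightarrow> False"
  proof (cases "\<exists>B\<in>\<B>. a \<le> card (K \<inter> B)")
    case True
    then obtain B where B: "B \<in> \<B>" "a \<le> card (K \<inter> B)" by blast
    show thesis
    proof (rule that[of "K \<inter> B"])
      show "False" if "x \<in> K \<inter> B" "y \<in> K - K \<inter> B" "B' \<in> \<B>" "x \<in> B'" "y \<in> B'" for x y B'
        using that B dis by (auto simp: pairwise_def disjnt_def)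
    qed (use B small in auto)
  next
    case False
    \<comment> \<open>Each block now covers at most \<open>a - 1\<close> vertices of
      \<open>K\<close>, so \<open>big(2)\<close> leaves at least \<open>a\<close> vertices in no
      block.\<close>
    let ?O = "K - \<Union>\<B>"
    have "K = ?O \<union> (\<Union>B\<in>\<B>. K \<inter> B)" by blast
    then have "card K \<le> card ?O + card (\<Union>B\<in>\<B>. K \<inter> B)"
      by (metis card_Un_le)
    also have "card (\<Union>B\<in>\<B>. K \<inter> B) \<le> (\<Sum>B\<in>\<B>. card (K \<inter> B))"
      using fin by (intro card_UN_le) auto
    also have "\<dots> \<le> (\<Sum>B\<in>\<B>. a - 1)"
      using False by (intro sum_mono) force
    finally have "card K \<le> card ?O + card \<B> * (a - 1)" by simp
    with big(2) have "a \<le> card ?O" by (cases a) (auto simp: algebra_simps)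
    then obtain A where "A \<subseteq> ?O" "card A = a"
      by (meson obtain_subset_with_card_n)
    then show thesis using big by (intro that[of A]) auto
  qed
  have finA: "finite A" using A fin finite_subset by blast
  have "between A (K - A) \<subseteq> pairs K - (\<Union>B\<in>\<B>. pairs B)"
  proof
    fix e assume "e \<in> between A (K - A)"
    then obtain x y where "e = {x, y}" "x \<in> A" "y \<in> K - A" by (auto simp: between_def)
    then show "e \<in> pairs K - (\<Union>B\<in>\<B>. pairs B)"
      using A(1) cr[of x y] by auto
  qed
  then have "card (between A (K - A)) \<le> card (pairs K - (\<Union>B\<in>\<B>. pairs B))"
    using fin by (intro card_mono) auto
  moreover have "card (between A (K - A)) = card A * (card K - card A)"
    using A fin finA by (subst card_between) (auto simp: card_Diff_subset)
  moreover obtain s where s: "card A = a + s" using A le_Suc_ex by blast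
  moreover obtain t where t: "card K = card A + a + t" using A le_Suc_ex by blast
  \<comment> \<open>The right side exceeds the left by exactly \<open>s * t\<close>.\<close>
  have "a * (card K - a) \<le> card A * (card K - card A)"
    using s t by (simp add: algebra_simps)
  ultimately show ?thesis by simp
qed

text \<open>Disjoint blocks have disjoint edge sets. In the applications the blocks are the cliques
  of one system and \<open>X\<close> collects edges gained from another system.\<close>

lemma card_edges_ge:
  assumes fin: "finite E" "finite \<B>" "\<And>B. B \<in> \<B> \<Longrightarrow> finite B" and dis: "pairwise disjnt \<B>"
    and sub: "\<And>B. B \<in> \<B> \<Longrightarrow> pairs B \<subseteq> E" "X \<subseteq> E" "X \<inter> (\<Union>B\<in>\<B>. pairs B) = {}"
  shows "(\<Sum>B\<in>\<B>. card B choose 2) + card X \<le> card E"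
proof -
  have "card (\<Union>B\<in>\<B>. pairs B) = (\<Sum>B\<in>\<B>. card (pairs B))"
  proof (rule card_UN_disjoint)
    show "\<forall>i\<in>\<B>. \<forall>j\<in>\<B>. i \<noteq> j \<longrightarrow> pairs i \<inter> pairs j = {}"
      using dis fin by (intro ballI impI pairs_disjoint) (auto simp: pairwise_def disjnt_def)
  qed (use fin in auto)
  also have "\<dots> = (\<Sum>B\<in>\<B>. card B choose 2)"
    using fin by (simp add: card_pairs)
  finally have "(\<Sum>B\<in>\<B>. card B choose 2) + card X = card ((\<Union>B\<in>\<B>. pairs B) \<union> X)"
    using fin sub finite_subset[OF sub(2) fin(1)] by (subst card_Un_disjoint) auto
  also have "\<dots> \<le> card E"
    using sub by (intro card_mono fin) auto
  finally show ?thesis .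
qed

text \<open>Sets of equal size that pairwise differ in one element either share all but one element or
  live in a common superset with one more element; the avoidance hypothesis excludes the former.\<close>

lemma near_family:
  assumes card: "\<And>R. R \<in> \<R> \<Longrightarrow> finite R \<and> card R = m" and m: "2 \<le> m"
    and near: "\<And>R R'. R \<in> \<R> \<Longrightarrow> R' \<in> \<R> \<Longrightarrow> card (R' - R) \<le> 1"
    and avoid: "\<And>w. \<exists>R\<in>\<R>. w \<notin> R"
  shows "\<exists>Z. finite Z \<and> card Z = m + 1 \<and> (\<forall>w\<in>Z. Z - {w} \<in> \<R>) \<and> (\<forall>R\<in>\<R>. R \<subseteq> Z)"
proof -
  have near': "x = y" if "R \<in> \<R>" "R' \<in> \<R>" "x \<in> R' - R" "y \<in> R' - R" for R R' x y
    using near[OF that(1,2)] that card[OF that(2)]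
    by (metis card_le_Suc0_iff_eq One_nat_def finite_Diff)
  \<comment> \<open>Equal size and \<open>near'\<close> leave one element on each side of the
    difference, so a member avoiding \<open>w\<close> arises from \<open>R\<close> by exchanging
    \<open>w\<close>.\<close>
  have swap: "\<exists>z. z \<notin> R \<and> R' = insert z (R - {w})"
    if "R \<in> \<R>" "R' \<in> \<R>" "w \<in> R" "w \<notin> R'" for R R' w
  proof -
    have f: "finite R" "finite R'" "card R = card R'" using card that by auto
    have "\<not> R' \<subseteq> R" using f that card_subset_eq[of R R'] by auto
    then obtain z where z: "z \<in> R'" "z \<notin> R" by blast
    have "R' \<subseteq> insert z (R - {w})" using near'[OF that(1,2)] z that by auto
    moreover have "card (insert z (R - {w})) = card R'"
      using f z that card_gt_0_iff[of R] by auto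
    ultimately have "R' = insert z (R - {w})" using f by (intro card_subset_eq) auto
    with z show ?thesis by blast
  qed
  obtain R where R: "R \<in> \<R>" using avoid by blast
  obtain w where w: "w \<in> R" using card[OF R] m by fastforce
  obtain R1 where R1: "R1 \<in> \<R>" "w \<notin> R1" using avoid by blast
  obtain z where z: "z \<notin> R" "R1 = insert z (R - {w})" using swap[OF R R1(1) w R1(2)] by blast
  define Z where "Z = insert z R"
  have finZ: "finite Z" "card Z = m + 1" using card[OF R] z by (auto simp: Z_def)
  have sub: "R' \<subseteq> Z" if R': "R' \<in> \<R>" for R'
  proof
    fix y assume y: "y \<in> R'"
    show "y \<in> Z"
    proof (rule ccontr)
      assume yZ: "y \<notin> Z"
      \<comment> \<open>\<open>y\<close> is the only element of \<open>R'\<close> outside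
        \<open>R\<close>, and also the only one outside \<open>R1\<close>; moreover
        \<open>R \<inter> R1 = R - {w}\<close>.\<close>
      have "R' \<subseteq> insert y (R - {w})"
      proof
        fix x assume x: "x \<in> R'"
        have "x \<in> R" if "x \<noteq> y" using near'[OF R R', of x y] that x y yZ by (auto simp: Z_def)
        moreover have "x \<in> R1" if "x \<noteq> y"
          using near'[OF R1(1) R', of x y] that x y yZ z(2) by (auto simp: Z_def)
        ultimately show "x \<in> insert y (R - {w})" using R1(2) by auto
      qed
      moreover have "card (insert y (R - {w})) = card R'"
        using card[OF R] card[OF R'] w yZ m by (simp add: Z_def)
      ultimately have R'eq: "R' = insert y (R - {w})"
        using card[OF R] by (intro card_subset_eq) auto
      \<comment> \<open>\<open>R\<close>, \<open>R1\<close> and \<open>R'\<close> all contain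
        \<open>R - {w}\<close>. A member \<open>T\<close> avoiding some \<open>u\<close> of this
        common part keeps everything else of each of the three, hence both \<open>z\<close> and
        \<open>y\<close>; but \<open>T\<close> has only one element outside
        \<open>R\<close>.\<close>
      have "card (R - {w}) > 0" using card[OF R] w m by simp
      then obtain u where u: "u \<in> R" "u \<noteq> w" by (metis Diff_iff card_gt_0_iff ex_in_conv singletonI)
      obtain T where T: "T \<in> \<R>" "u \<notin> T" using avoid by blast
      obtain t0 where t0: "t0 \<notin> R" "T = insert t0 (R - {u})" using swap[OF R T(1) u(1) T(2)] by blast
      obtain t1 where t1: "T = insert t1 (R1 - {u})"
        using swap[OF R1(1) T(1) _ T(2)] u z by auto
      obtain t2 where t2: "T = insert t2 (R' - {u})"
        using swap[OF R' T(1) _ T(2)] u R'eq by auto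
      have "z \<in> T" "y \<in> T" using t1 t2 z R'eq u yZ by (auto simp: Z_def)
      then show False using t0 z yZ by (auto simp: Z_def)
    qed
  qed
  \<comment> \<open>A member avoiding \<open>w\<close> is contained in \<open>Z - {w}\<close>, and
    both have \<open>m\<close> elements.\<close>
  have "Z - {w} \<in> \<R>" if "w \<in> Z" for w
  proof -
    obtain R' where R': "R' \<in> \<R>" "w \<notin> R'" using avoid by blast
    have "R' = Z - {w}"
      using sub[OF R'(1)] R' card[OF R'(1)] finZ that by (intro card_subset_eq) auto
    with R' show ?thesis by simp
  qed
  with finZ sub show ?thesis by blast
qed

section \<open>Cliques in an edge set and the edges forced by avoidable cliques\<close>

lemma pairs_subset_if_deletions:
  assumes "finite Z" "card Z \<ge> 3" "\<And>w. w \<in> Z \<Longrightarrow> pairs (Z - {w}) \<subseteq> E"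
  shows "pairs Z \<subseteq> E"
proof
  fix e assume e: "e \<in> pairs Z"
  then have "e \<subseteq> Z" "card e = 2" by (auto simp: pairs_def)
  then have "\<not> Z \<subseteq> e" using assms(2) by auto
  then obtain w where "w \<in> Z" "w \<notin> e" by blast
  then have "e \<in> pairs (Z - {w})" using e by (auto simp: pairs_def)
  with assms \<open>w \<in> Z\<close> show "e \<in> E" by blast
qed

text \<open>Relative to a bare edge set because the edges vary while the vertices stay:
  \<open>pairs Z\<close> is deleted, edges are restricted to the part outside a core, or one edge is
  inserted.\<close>

definition clique :: "'a set set \<Rightarrow> nat \<Rightarrow> 'a set \<Rightarrow> bool" where
  "clique E m K \<longleftrightarrow> finite K \<and> card K = m \<and> pairs K \<subseteq> E"

lemma cliqueD: "clique E m K \<Longrightarrow> finite K" "clique E m K \<Longrightarrow> card K = m"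
  "clique E m K \<Longrightarrow> pairs K \<subseteq> E"
  by (auto simp: clique_def)

lemma card_Int_Diff_eq: "finite A \<Longrightarrow> card (A \<inter> B) + card (A - B) = card A"
  by (metis card_Un_disjoint finite_Diff finite_Int Int_Diff_disjoint Int_Diff_Un)

text \<open>Every deletion \<open>Z - {w}\<close> of the set from \<open>near_family\<close> is a
  clique, and since \<open>Z\<close> has at least three vertices each of its pairs survives in some
  deletion.\<close>

lemma near_cliques:
  assumes cl: "\<And>R. R \<in> \<R> \<Longrightarrow> clique E m R" and m: "2 \<le> m"
    and near: "\<And>R R'. R \<in> \<R> \<Longrightarrow> R' \<in> \<R> \<Longrightarrow> card (R' - R) \<le> 1"
    and avoid: "\<And>w. \<exists>R\<in>\<R>. w \<notin> R"
  shows "\<exists>Z. clique E (m + 1) Z \<and> (\<forall>R\<in>\<R>. R \<subseteq> Z)"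
proof -
  have "finite R \<and> card R = m" if "R \<in> \<R>" for R using cl[OF that] by (simp add: clique_def)
  from near_family[OF this m near avoid]
  obtain Z where Z: "finite Z" "card Z = m + 1" "\<And>w. w \<in> Z \<Longrightarrow> Z - {w} \<in> \<R>"
    "\<forall>R\<in>\<R>. R \<subseteq> Z" by blast
  have "pairs Z \<subseteq> E"
  proof (rule pairs_subset_if_deletions)
    show "pairs (Z - {w}) \<subseteq> E" if "w \<in> Z" for w using cl[OF Z(3)[OF that]] by (rule cliqueD(3))
  qed (use Z(1,2) m in simp_all)
  with Z show ?thesis by (intro exI[of _ Z]) (simp add: clique_def)
qed

text \<open>If two \<open>m\<close>-cliques differ in at least two vertices,
  \<open>crossing_pairs\<close> with \<open>a = 2\<close> gives \<open>2 * (m - 2)\<close> edges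
  outside the first, and this is at least the missing \<open>m\<close> because
  \<open>4 \<le> m\<close>. Otherwise \<open>near_cliques\<close> produces a clique of order
  \<open>m + 1\<close>.\<close>

lemma card_edges_ge_one:
  assumes E: "finite E" and m: "4 \<le> m" and avoid: "\<And>w. \<exists>K. clique E m K \<and> w \<notin> K"
  shows "(m + 1) choose 2 \<le> card E"
proof (cases "\<exists>K K'. clique E m K \<and> clique E m K' \<and> 2 \<le> card (K' - K)")
  case True
  then obtain K K' where K: "clique E m K" "clique E m K'" "2 \<le> card (K' - K)" by blast
  note D = K(1,2)[THEN cliqueD(1)] K(1,2)[THEN cliqueD(2)] K(1,2)[THEN cliqueD(3)]
  have "2 * (card K' - 2) \<le> card (pairs K' - (\<Union>B\<in>{K}. pairs B))"
    using D m K(3) card_Int_Diff_eq[of K' K] by (intro crossing_pairs) auto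
  moreover have "(\<Sum>B\<in>{K}. card B choose 2) + card (pairs K' - (\<Union>B\<in>{K}. pairs B)) \<le> card E"
    using D E by (intro card_edges_ge) auto
  ultimately show ?thesis using D m by (simp add: choose_two_Suc del: One_nat_def)
next
  case False
  have "\<exists>Z. clique E (m + 1) Z \<and> (\<forall>R\<in>{K. clique E m K}. R \<subseteq> Z)"
  proof (rule near_cliques)
    show "\<exists>R\<in>{K. clique E m K}. w \<notin> R" for w using avoid[of w] by blast
    show "card (R' - R) \<le> 1" if "R \<in> {K. clique E m K}" "R' \<in> {K. clique E m K}" for R R'
      using False that by (metis Suc_1 mem_Collect_eq not_less_eq_eq One_nat_def)
  qed (use m in auto)
  then obtain Z where Z: "clique E (m + 1) Z" by blast
  then have "card (pairs Z) \<le> card E" using E by (intro card_mono) (auto dest: cliqueD)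
  with Z show ?thesis by (metis card_pairs clique_def)
qed

lemma clique_remove_pairs:
  assumes "clique E m K" "card (K \<inter> Z) \<le> 1"
  shows "clique (E - pairs Z) m K"
  using assms pairs_disjoint[of K Z] by (auto simp: clique_def)

text \<open>If two of the \<open>q\<close>-cliques differ in at least two vertices,
  \<open>2 * (q - 2)\<close> new edges appear, and the gap \<open>p + 4 \<le> q\<close> makes this
  at least \<open>p + q\<close>. Otherwise all of them lie in one clique \<open>Z\<close> of order
  \<open>q + 1\<close>; deleting its edges reduces to a single clique.\<close>

lemma card_edges_ge_two:
  assumes E: "finite E" and m: "4 \<le> p" "p + 4 \<le> q"
    and avoid: "\<And>w. \<exists>P Q. clique E p P \<and> clique E q Q \<and> P \<inter> Q = {} \<and> w \<notin> P \<union> Q"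
  shows "((p + 1) choose 2) + ((q + 1) choose 2) \<le> card E"
proof -
  define copy where "copy P Q \<longleftrightarrow> clique E p P \<and> clique E q Q \<and> P \<inter> Q = {}" for P Q
  show ?thesis
  proof (cases "\<exists>P Q P' Q'. copy P Q \<and> copy P' Q' \<and> 2 \<le> card (Q' - Q)")
    case True
    then obtain P Q Q' where K: "clique E p P" "clique E q Q" "clique E q Q'" "P \<inter> Q = {}"
      "2 \<le> card (Q' - Q)" by (auto simp: copy_def)
    note D = K(1-3)[THEN cliqueD(1)] K(1-3)[THEN cliqueD(2)] K(1-3)[THEN cliqueD(3)]
    have ne: "P \<noteq> Q" using D m by auto
    have dj: "pairwise disjnt {P, Q}" using K by (auto simp: pairwise_def disjnt_def)
    have "card (Q' \<inter> P) \<le> p" using D by (metis card_mono Int_lower2)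
    then have "2 * (card Q' - 2) \<le> card (pairs Q' - (\<Union>B\<in>{P, Q}. pairs B))"
      using D m K(5) card_Int_Diff_eq[of Q' Q] dj ne by (intro crossing_pairs) auto
    moreover have "(\<Sum>B\<in>{P, Q}. card B choose 2) + card (pairs Q' - (\<Union>B\<in>{P, Q}. pairs B)) \<le> card E"
      using D E dj by (intro card_edges_ge) auto
    ultimately show ?thesis using D m ne by (simp add: choose_two_Suc del: One_nat_def)
  next
    case False
    have "\<exists>Z. clique E (q + 1) Z \<and> (\<forall>R\<in>{Q. \<exists>P. copy P Q}. R \<subseteq> Z)"
    proof (rule near_cliques)
      show "\<exists>R\<in>{Q. \<exists>P. copy P Q}. w \<notin> R" for w using avoid[of w] by (auto simp: copy_def)
      show "card (R' - R) \<le> 1" if "R \<in> {Q. \<exists>P. copy P Q}" "R' \<in> {Q. \<exists>P. copy P Q}" for R R'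
      proof (rule ccontr)
        assume "\<not> card (R' - R) \<le> 1"
        then have "2 \<le> card (R' - R)" by simp
        with that False show False by blast
      qed
    qed (use m in \<open>auto simp: copy_def\<close>)
    then obtain Z where Z: "clique E (q + 1) Z" and sub: "\<And>P Q. copy P Q \<Longrightarrow> Q \<subseteq> Z" by blast
    \<comment> \<open>\<open>Q\<close> fills all but one vertex of \<open>Z\<close>, so the disjoint
      \<open>P\<close> has no edge inside \<open>Z\<close> and survives the deletion.\<close>
    have small: "card (P \<inter> Z) \<le> 1" if "copy P Q" for P Q
    proof -
      have "Q \<subseteq> Z" "P \<inter> Z \<subseteq> Z - Q" using that sub[OF that] by (auto simp: copy_def)
      moreover have "card (Z - Q) = 1" using Z that \<open>Q \<subseteq> Z\<close>
        by (simp add: copy_def clique_def card_Diff_subset)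
      moreover have "finite (Z - Q)" using Z by (auto dest: cliqueD)
      ultimately show ?thesis by (metis card_mono)
    qed
    have "(p + 1) choose 2 \<le> card (E - pairs Z)"
    proof (rule card_edges_ge_one)
      show "\<exists>K. clique (E - pairs Z) p K \<and> w \<notin> K" for w
      proof -
        obtain P Q where "copy P Q" "w \<notin> P" using avoid[of w] by (auto simp: copy_def)
        then show ?thesis using small[of P Q] clique_remove_pairs[of E p P Z] by (auto simp: copy_def)
      qed
    qed (use E m in auto)
    moreover have "card (pairs Z) = (q + 1) choose 2" using Z by (metis card_pairs clique_def)
    moreover have "card (E - pairs Z) + card (pairs Z) = card E"
      using Z E by (metis add.commute card_Int_Diff_eq clique_def inf.absorb_iff2)
    ultimately show ?thesis by simp
  qed
qed

text \<open>Split by the largest difference of two \<open>r\<close>-cliques. At least three: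
  \<open>crossing_pairs\<close> with \<open>a = 3\<close> gives \<open>3 * (r - 3)\<close> new
  edges, which is enough. At most one: all \<open>r\<close>-cliques lie in a clique of order
  \<open>r + 1\<close>, whose edges are deleted to reach \<open>card_edges_ge_two\<close>. Exactly
  two: \<open>2 * (r - 2)\<close> edges can fall short of \<open>p + q + r\<close>, so a second
  \<open>q\<close>-clique has to help.\<close>

lemma card_edges_ge_three:
  assumes E: "finite E" and m: "4 \<le> p" "p + 4 \<le> q" "q + 4 \<le> r"
    and avoid: "\<And>w. \<exists>P Q R. clique E p P \<and> clique E q Q \<and> clique E r R
      \<and> P \<inter> Q = {} \<and> P \<inter> R = {} \<and> Q \<inter> R = {} \<and> w \<notin> P \<union> Q \<union> R"
  shows "((p + 1) choose 2) + ((q + 1) choose 2) + ((r + 1) choose 2) \<le> card E"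
proof -
  define copy where "copy P Q R \<longleftrightarrow> clique E p P \<and> clique E q Q \<and> clique E r R
      \<and> P \<inter> Q = {} \<and> P \<inter> R = {} \<and> Q \<inter> R = {}" for P Q R
  define extra where "extra P Q R K = pairs K - (\<Union>B\<in>{P, Q, R}. pairs B)" for P Q R K :: "'a set"
  \<comment> \<open>Passing from \<open>k choose 2\<close> to \<open>(k + 1) choose 2\<close> costs
    \<open>k\<close>, so \<open>p + q + r\<close> edges outside the three cliques suffice.\<close>
  have enough: ?thesis
    if c: "copy P Q R" and X: "X \<subseteq> E" "X \<inter> (\<Union>B\<in>{P, Q, R}. pairs B) = {}" "p + q + r \<le> card X"
    for P Q R X
  proof -
    have "(\<Sum>B\<in>{P, Q, R}. card B choose 2) + card X \<le> card E"
      using c E X(1,2) by (intro card_edges_ge) (auto simp: copy_def clique_def pairwise_def disjnt_def)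
    moreover have "P \<noteq> Q" "P \<noteq> R" "Q \<noteq> R" using c m by (auto simp: copy_def clique_def)
    ultimately show ?thesis using c X(3)
      by (simp add: choose_two_Suc copy_def clique_def del: One_nat_def)
  qed
  have extra_ge: "a * (card K - a) \<le> card (extra P Q R K)"
    if c: "copy P Q R" and K: "clique E k K" "\<And>B. B \<in> {P, Q, R} \<Longrightarrow> card (K \<inter> B) + a \<le> k"
      "2 * a \<le> k" "(a - 1) * 4 < k"
    for P Q R K a k
    unfolding extra_def
  proof (rule crossing_pairs)
    have "P \<noteq> Q" "P \<noteq> R" "Q \<noteq> R" using c m by (auto simp: copy_def clique_def)
    then show "(a - 1) * (card {P, Q, R} + 1) < card K" using K(1,4) by (simp add: clique_def)
    show "card (K \<inter> B) + a \<le> card K" if "B \<in> {P, Q, R}" for B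
      using K(1) K(2)[OF that] by (simp add: clique_def)
    show "pairwise disjnt {P, Q, R}" using c by (auto simp: copy_def pairwise_def disjnt_def)
  qed (use K(1,3) in \<open>simp_all add: clique_def\<close>)
  have extra_sub: "extra P Q R K \<subseteq> E" "extra P Q R K \<inter> (\<Union>B\<in>{P, Q, R}. pairs B) = {}"
    "finite (extra P Q R K)" "extra P Q R K \<subseteq> pairs K"
    if "clique E k K" for P Q R K k
    using that by (auto simp: extra_def clique_def)
  have le: "card (K \<inter> P) \<le> p" "card (K \<inter> Q) \<le> q" if "copy P Q R" for K P Q R
    using that by (auto simp: copy_def clique_def intro!: card_mono)
  \<comment> \<open>\<open>R'\<close> contributes \<open>2 (r - 2)\<close> and \<open>Q'\<close> at least \<open>q - 1\<close> further edges, and they share none.\<close>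
  have two: ?thesis
    if c: "copy P Q R" and R': "clique E r R'" "card (R' - R) = 2"
      and Q': "clique E q Q'" "Q' \<noteq> Q" "card (Q' \<inter> R) \<le> 2" "card (Q' \<inter> R') \<le> 1"
    for P Q R Q' R'
  proof -
    have "card (R' \<inter> R) + 2 = r" using R' card_Int_Diff_eq[of R' R] by (simp add: cliqueD)
    then have 1: "2 * (card R' - 2) \<le> card (extra P Q R R')"
      using m le[OF c, of R'] by (intro extra_ge[OF c R'(1)]) auto
    \<comment> \<open>Distinct cliques of equal order: \<open>Q'\<close> has a vertex outside
      \<open>Q\<close>, so \<open>crossing_pairs\<close> applies with \<open>a = 1\<close>.\<close>
    have "card (Q' \<inter> Q) \<noteq> q"
      using c Q' card_subset_eq[of Q "Q' \<inter> Q"] card_subset_eq[of Q' "Q' \<inter> Q"]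
      by (auto simp: copy_def clique_def)
    then have "card (Q' \<inter> Q) + 1 \<le> q" using le(2)[OF c, of Q'] by auto
    then have 2: "1 * (card Q' - 1) \<le> card (extra P Q R Q')"
      using m le[OF c, of Q'] Q' by (intro extra_ge[OF c Q'(1)]) auto
    have "extra P Q R R' \<inter> extra P Q R Q' = {}"
      using extra_sub(4)[OF R'(1), of P Q R] extra_sub(4)[OF Q'(1), of P Q R]
        pairs_disjoint[OF _ Q'(4)] cliqueD(1)[OF Q'(1)] by blast
    then have "card (extra P Q R R' \<union> extra P Q R Q') = card (extra P Q R R') + card (extra P Q R Q')"
      using extra_sub(3)[OF R'(1)] extra_sub(3)[OF Q'(1)] by (intro card_Un_disjoint) auto
    then have "p + q + r \<le> card (extra P Q R R' \<union> extra P Q R Q')"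
      using 1 2 m R' Q' by (simp add: cliqueD)
    then show ?thesis
      using extra_sub(1,2)[OF R'(1), of P Q R] extra_sub(1,2)[OF Q'(1), of P Q R]
      by (intro enough[OF c, of "extra P Q R R' \<union> extra P Q R Q'"]) auto
  qed
  show ?thesis
  proof (cases "\<exists>P Q R P' Q' R'. copy P Q R \<and> copy P' Q' R' \<and> 3 \<le> card (R' - R)")
    case True
    then obtain P Q R R' where c: "copy P Q R" and R': "clique E r R'" "3 \<le> card (R' - R)"
      by (auto simp: copy_def)
    have "card (R' \<inter> R) + 3 \<le> r" using R' card_Int_Diff_eq[of R' R] by (simp add: cliqueD)
    then have "3 * (card R' - 3) \<le> card (extra P Q R R')"
      using m le[OF c, of R'] by (intro extra_ge[OF c R'(1)]) auto
    then show ?thesis using m R' extra_sub(1,2)[OF R'(1), of P Q R]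
      by (intro enough[OF c, of "extra P Q R R'"]) (auto simp: cliqueD)
  next
    case F3: False
    have le2: "card (R' - R) \<le> 2" if "copy P Q R" "copy P' Q' R'" for P Q R P' Q' R'
    proof (rule ccontr)
      assume "\<not> card (R' - R) \<le> 2"
      then have "3 \<le> card (R' - R)" by simp
      with that F3 show False by blast
    qed
    have meet: "card (K \<inter> R) \<le> card (R - R')" if "copy P Q R" "K \<inter> R' = {}" for P Q R K R'
      using that by (intro card_mono) (auto simp: copy_def clique_def)
    show ?thesis
    proof (cases "\<exists>P Q R P' Q' R'. copy P Q R \<and> copy P' Q' R' \<and> card (R' - R) = 2")
      case True
      then obtain P Q R P' Q' R' where c: "copy P Q R" "copy P' Q' R'" "card (R' - R) = 2" by blast
      have two': ?thesis if c: "copy P Q R" "copy P' Q' R'" "card (R' - R) = 2" "Q' \<noteq> Q"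
        for P Q R P' Q' R'
      proof (rule two[OF c(1) _ c(3) _ c(4)])
        show "card (Q' \<inter> R) \<le> 2"
          using meet[OF c(1), of Q' R'] le2[OF c(2,1)] c(2) by (auto simp: copy_def)
      qed (use c in \<open>auto simp: copy_def\<close>)
      \<comment> \<open>If \<open>Q' = Q\<close>, these two copies may give too few edges; a third
        copy avoiding a vertex of \<open>Q\<close> brings a different
        \<open>q\<close>-clique.\<close>
      obtain w where w: "w \<in> Q" using c m by (fastforce simp: copy_def clique_def)
      obtain P'' Q'' R'' where c'': "copy P'' Q'' R''" "w \<notin> Q''"
        using avoid[of w] by (auto simp: copy_def)
      \<comment> \<open>If \<open>R''\<close> differs in two vertices from \<open>R\<close> or from
        \<open>R'\<close>, the third copy is paired with that copy. Otherwise \<open>R''\<close>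
        nearly agrees with both, so \<open>Q''\<close>, being disjoint from \<open>R''\<close>,
        hardly meets \<open>R\<close> and \<open>R'\<close>, and \<open>R'\<close> is combined with
        \<open>Q''\<close>.\<close>
      consider "Q' \<noteq> Q" | "card (R'' - R) = 2" | "Q' = Q" "card (R' - R'') = 2"
        | "card (R'' - R) \<le> 1" "card (R' - R'') \<le> 1"
        using le2[OF c(1) c''(1)] le2[OF c''(1) c(2)] by linarith
      then show ?thesis
      proof cases
        case 1 then show ?thesis using two'[OF c] by blast
      next
        case 2 then show ?thesis using two'[OF c(1) c''(1)] w c'' by blast
      next
        case 3 then show ?thesis using two'[OF c''(1) c(2)] w c'' by blast
      next
        case 4
        show ?thesis
        proof (rule two[OF c(1) _ c(3)])
          show "card (Q'' \<inter> R) \<le> 2"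
            using meet[OF c(1), of Q'' R''] le2[OF c''(1) c(1)] c''(1) by (auto simp: copy_def)
          show "card (Q'' \<inter> R') \<le> 1"
            using meet[OF c(2), of Q'' R''] 4 c''(1) by (auto simp: copy_def)
        qed (use c c'' w in \<open>auto simp: copy_def\<close>)
      qed
    next
      case False
      have le1: "card (R' - R) \<le> 1" if "copy P Q R" "copy P' Q' R'" for P Q R P' Q' R'
      proof -
        have "card (R' - R) \<noteq> 2" using False that by blast
        with le2[OF that] show ?thesis by simp
      qed
      let ?\<R> = "{R. \<exists>P Q. copy P Q R}"
      have "\<exists>Z. clique E (r + 1) Z \<and> (\<forall>R\<in>?\<R>. R \<subseteq> Z)"
      proof (rule near_cliques)
        show "\<exists>R\<in>?\<R>. w \<notin> R" for w using avoid[of w] by (auto simp: copy_def)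
        show "card (R' - R) \<le> 1" if "R \<in> ?\<R>" "R' \<in> ?\<R>" for R R'
          using le1 that by blast
      qed (use m in \<open>auto simp: copy_def\<close>)
      then obtain Z where Z: "clique E (r + 1) Z" and sub: "\<And>P Q R. copy P Q R \<Longrightarrow> R \<subseteq> Z" by blast
      have small: "card (K \<inter> Z) \<le> 1" if "copy P Q R" "K \<inter> R = {}" for K P Q R
      proof -
        have "R \<subseteq> Z" "K \<inter> Z \<subseteq> Z - R" using that(2) sub[OF that(1)] by auto
        moreover have "card (Z - R) = 1" using Z that \<open>R \<subseteq> Z\<close>
          by (simp add: copy_def clique_def card_Diff_subset)
        moreover have "finite (Z - R)" using Z by (auto dest: cliqueD)
        ultimately show ?thesis by (metis card_mono)
      qed
      have "((p + 1) choose 2) + ((q + 1) choose 2) \<le> card (E - pairs Z)"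
      proof (rule card_edges_ge_two)
        fix w
        obtain P Q R where c: "copy P Q R" "w \<notin> P \<union> Q"
          using avoid[of w] by (auto simp: copy_def)
        show "\<exists>P Q. clique (E - pairs Z) p P \<and> clique (E - pairs Z) q Q \<and> P \<inter> Q = {} \<and> w \<notin> P \<union> Q"
          using c small[OF c(1), of P] small[OF c(1), of Q]
          by (intro exI[of _ P] exI[of _ Q]) (auto simp: copy_def intro!: clique_remove_pairs)
      qed (use E m in auto)
      moreover have "card (pairs Z) = (r + 1) choose 2" using Z by (metis card_pairs clique_def)
      moreover have "card (E - pairs Z) + card (pairs Z) = card E"
        using Z E by (metis add.commute card_Int_Diff_eq clique_def inf.absorb_iff2)
      ultimately show ?thesis by simp
    qed
  qed
qed

section \<open>Clique unions and saturation\<close>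

lemma image_pairs:
  assumes "inj_on f A"
  shows "(`) f ` pairs A = pairs (f ` A)"
proof
  show "(`) f ` pairs A \<subseteq> pairs (f ` A)"
    using assms by (auto simp: pairs_def card_image inj_on_subset)
  show "pairs (f ` A) \<subseteq> (`) f ` pairs A"
  proof
    fix e assume "e \<in> pairs (f ` A)"
    then have "e \<subseteq> f ` A" "card e = 2" by (auto simp: pairs_def)
    then obtain e' where e': "e' \<subseteq> A" "e = f ` e'" by (auto simp: subset_image_iff)
    then have "card e' = 2" using \<open>card e = 2\<close> assms by (simp add: card_image inj_on_subset)
    with e' show "e \<in> (`) f ` pairs A" by (auto simp: pairs_def)
  qed
qed

lemma verts_clique_union: "verts (clique_union ps) = (\<Union>i<length ps. Pair i ` {..<ps ! i})"
  by (auto simp: clique_union_def disjoint_union_def complete_graph_def)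

lemma edges_clique_union: "edges (clique_union ps) = (\<Union>i<length ps. pairs (Pair i ` {..<ps ! i}))"
proof -
  have "(`) (Pair i) ` edges (complete_graph m) = pairs (Pair i ` {..<m})" for i m :: nat
    using image_pairs[of "Pair i" "{..<m}"] by (simp add: complete_graph_def pairs_def inj_on_def)
  then show ?thesis by (simp add: clique_union_def disjoint_union_def)
qed

text \<open>Indexed by position, not by order, because entries of \<open>ps\<close> may coincide
  (\<open>p1 = p2\<close> is allowed); values of \<open>K\<close> beyond the list are
  arbitrary.\<close>

definition clique_family :: "'a graph \<Rightarrow> nat list \<Rightarrow> (nat \<Rightarrow> 'a set) \<Rightarrow> bool" where
  "clique_family G ps K \<longleftrightarrow>
     (\<forall>i<length ps. K i \<subseteq> verts G \<and> clique (edges G) (ps ! i) (K i))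
     \<and> (\<forall>i<length ps. \<forall>j<length ps. i \<noteq> j \<longrightarrow> K i \<inter> K j = {})"

lemma clique_familyD:
  assumes "clique_family G ps K"
  shows "i < length ps \<Longrightarrow> K i \<subseteq> verts G" "i < length ps \<Longrightarrow> clique (edges G) (ps ! i) (K i)"
    "i < length ps \<Longrightarrow> j < length ps \<Longrightarrow> i \<noteq> j \<Longrightarrow> K i \<inter> K j = {}"
  using assms by (auto simp: clique_family_def)

text \<open>The cliques are the preimages of the components under the isomorphism.\<close>

lemma contains_copy_clique_unionD:
  assumes "contains_copy G (clique_union ps)"
  shows "\<exists>K. clique_family G ps K"
proof -
  obtain S f where S: "subgraph S G" and f: "bij_betw f (verts S) (verts (clique_union ps))"
    "(`) f ` edges S = edges (clique_union ps)"
    using assms by (auto simp: contains_copy_def isomorphic_def)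
  define B where "B i = Pair i ` {..<ps ! i}" for i
  define K where "K i = {x \<in> verts S. f x \<in> B i}" for i
  have inj: "inj_on f (verts S)" using f by (simp add: bij_betw_def)
  have sim: "finite (verts S)" "e \<in> edges S \<Longrightarrow> e \<subseteq> verts S" for e
    using S by (auto simp: subgraph_def simple_graph_def)
  have "clique (edges G) (ps ! i) (K i)" if i: "i < length ps" for i
  proof -
    have injK: "inj_on f (K i)" using inj by (rule inj_on_subset) (auto simp: K_def)
    have "B i \<subseteq> f ` verts S" using f i by (auto simp: bij_betw_def verts_clique_union B_def)
    then have im: "f ` K i = B i" by (auto simp: K_def)
    have "card (K i) = ps ! i"
      using card_image[OF injK] im by (simp add: B_def card_image inj_on_def)
    moreover have "pairs (K i) \<subseteq> edges S"
    proof
      fix e assume e: "e \<in> pairs (K i)"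
      then have "f ` e \<in> (`) f ` pairs (K i)" by (rule imageI)
      then have "f ` e \<in> pairs (B i)" by (simp only: image_pairs[OF injK] im)
      then have "f ` e \<in> (`) f ` edges S" using f(2) i by (auto simp: edges_clique_union B_def)
      then obtain e' where e': "e' \<in> edges S" "f ` e = f ` e'" by blast
      have "e \<subseteq> verts S" using e by (auto simp: K_def pairs_def)
      \<comment> \<open>\<open>f\<close> is injective on \<open>verts S\<close>, which contains both
        edges, so equal images mean equal edges.\<close>
      then have "e = e'" using inj_on_image_eq_iff[OF inj, of e e'] e' sim(2) by simp
      with e' show "e \<in> edges S" by simp
    qed
    ultimately show ?thesis using S sim by (auto simp: clique_def subgraph_def K_def)
  qed
  moreover have "K i \<subseteq> verts G" for i using S by (auto simp: K_def subgraph_def)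
  moreover have "K i \<inter> K j = {}" if "i \<noteq> j" for i j using that by (auto simp: K_def B_def)
  ultimately show ?thesis unfolding clique_family_def by blast
qed

text \<open>Bijections of the single cliques onto the components are glued together; disjointness
  makes the index \<open>ix x\<close> of a vertex unique. The subgraph \<open>S\<close> keeps only
  the edges inside the cliques, since the isomorphism must match edge sets exactly.\<close>

lemma contains_copy_clique_unionI:
  assumes "clique_family G ps K"
  shows "contains_copy G (clique_union ps)"
proof -
  note V = clique_familyD(1)[OF assms] and cl = clique_familyD(2)[OF assms]
    and dis = clique_familyD(3)[OF assms]
  define B where "B i = Pair i ` {..<ps ! i}" for i
  have "\<exists>h. bij_betw h (K i) (B i)" if "i < length ps" for i
    using cl[OF that]
    by (intro finite_same_card_bij) (auto simp: clique_def B_def card_image inj_on_def)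
  then obtain h where h: "\<And>i. i < length ps \<Longrightarrow> bij_betw (h i) (K i) (B i)" by metis
  define ix where "ix x = (THE i. i < length ps \<and> x \<in> K i)" for x
  define f where "f x = h (ix x) x" for x
  have ix: "ix x = i" if "i < length ps" "x \<in> K i" for i x
    unfolding ix_def using that dis by (intro the_equality) auto
  have f: "bij_betw f (K i) (B i)" if "i < length ps" for i
    using h[OF that] ix[OF that] by (simp add: f_def cong: bij_betw_cong)
  define S where "S = Graph (\<Union>i<length ps. K i) (\<Union>i<length ps. pairs (K i))"
  have "subgraph S G"
    using V cl by (fastforce simp: S_def subgraph_def simple_graph_def clique_def pairs_def)
  moreover have "bij_betw f (\<Union>i<length ps. K i) (\<Union>i<length ps. B i)"
    using f by (intro bij_betw_UNION_disjoint) (auto simp: disjoint_family_on_def B_def)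
  moreover have "(`) f ` pairs (K i) = pairs (B i)" if "i < length ps" for i
    using image_pairs[of f "K i"] f[OF that] by (simp add: bij_betw_def)
  then have "(`) f ` (\<Union>i<length ps. pairs (K i)) = (\<Union>i<length ps. pairs (B i))"
    by (simp add: image_UN)
  ultimately show ?thesis
    unfolding contains_copy_def isomorphic_def
    by (intro exI[of _ S]) (auto simp: S_def verts_clique_union edges_clique_union B_def)
qed

lemma clique_insert_edge:
  assumes "clique (insert {v, w} E) k K" "\<not> (v \<in> K \<and> w \<in> K)"
  shows "clique E k K"
  using assms by (auto simp: clique_def pairs_def)

text \<open>Some clique of the new copy must contain both ends of the added edge, as otherwise the
  copy would already be in \<open>G\<close>; by disjointness the other cliques contain neither
  end.\<close>

lemma saturated_new_clique:
  assumes sat: "saturated (clique_union ps) G" and vw: "v \<in> verts G" "w \<in> verts G" "v \<noteq> w"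
    "{v, w} \<notin> edges G"
  shows "\<exists>K i. i < length ps \<and> v \<in> K i \<and> w \<in> K i \<and> clique_family (add_edge G v w) ps K
    \<and> (\<forall>j<length ps. j \<noteq> i \<longrightarrow> clique (edges G) (ps ! j) (K j))"
proof -
  have no: "\<not> contains_copy G (clique_union ps)" using sat by (simp add: saturated_def)
  have "contains_copy (add_edge G v w) (clique_union ps)" using sat vw by (simp add: saturated_def)
  then obtain K where fam: "clique_family (add_edge G v w) ps K"
    using contains_copy_clique_unionD by blast
  note K = clique_familyD[OF fam]
  have V: "K j \<subseteq> verts G" if "j < length ps" for j
    using K(1)[OF that] by (simp add: add_edge_def)
  have cl: "clique (insert {v, w} (edges G)) (ps ! j) (K j)" if "j < length ps" for j
    using K(2)[OF that] by (simp add: add_edge_def)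
  have "\<exists>i<length ps. v \<in> K i \<and> w \<in> K i"
  proof (rule ccontr)
    assume none: "\<not> (\<exists>i<length ps. v \<in> K i \<and> w \<in> K i)"
    have "clique (edges G) (ps ! j) (K j)" if "j < length ps" for j
      using clique_insert_edge[OF cl[OF that]] that none by blast
    then have "clique_family G ps K" using V K(3) by (simp add: clique_family_def)
    with no show False using contains_copy_clique_unionI by blast
  qed
  then obtain i where i: "i < length ps" "v \<in> K i" "w \<in> K i" by blast
  have "clique (edges G) (ps ! j) (K j)" if "j < length ps" "j \<noteq> i" for j
    using clique_insert_edge[OF cl[OF that(1)]] K(3)[OF that(1) i(1) that(2)] i by blast
  with i fam show ?thesis by blast
qed

section \<open>Neighbourhoods and degree counting\<close>

definition nbrs :: "'a graph \<Rightarrow> 'a \<Rightarrow> 'a set" where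
  "nbrs G v = {u. {v, u} \<in> edges G}"

lemma nbrs_sym: "u \<in> nbrs G v \<longleftrightarrow> v \<in> nbrs G u"
  by (simp add: nbrs_def insert_commute)

lemma nbrs_simple:
  assumes "simple_graph G"
  shows "nbrs G v \<subseteq> verts G" "v \<notin> nbrs G v" "finite (nbrs G v)"
proof -
  show "nbrs G v \<subseteq> verts G" "v \<notin> nbrs G v"
    using assms by (force simp: nbrs_def simple_graph_def)+
  then show "finite (nbrs G v)" using assms finite_subset by (auto simp: simple_graph_def)
qed

lemma simple_graph_edges:
  assumes "simple_graph G"
  shows "edges G \<subseteq> pairs (verts G)" "finite (edges G)"
proof -
  show "edges G \<subseteq> pairs (verts G)" using assms by (auto simp: simple_graph_def pairs_def)
  then show "finite (edges G)"
    by (rule finite_subset) (use assms in \<open>simp add: simple_graph_def\<close>)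
qed

lemma handshake:
  assumes G: "simple_graph G"
  shows "(\<Sum>v\<in>verts G. card (nbrs G v)) = 2 * num_edges G"
proof -
  have "card (nbrs G v) = card {e \<in> edges G. v \<in> e}" for v
  proof -
    have "{e \<in> edges G. v \<in> e} = (\<lambda>u. {v, u}) ` nbrs G v"
    proof
      show "{e \<in> edges G. v \<in> e} \<subseteq> (\<lambda>u. {v, u}) ` nbrs G v"
      proof
        fix e assume e: "e \<in> {e \<in> edges G. v \<in> e}"
        then have "card e = 2" using G by (auto simp: simple_graph_def)
        then obtain u where "e = {v, u}" using e by (auto simp: card_2_iff)
        then show "e \<in> (\<lambda>u. {v, u}) ` nbrs G v" using e by (auto simp: nbrs_def)
      qed
    qed (auto simp: nbrs_def)
    moreover have "inj_on (\<lambda>u. {v, u}) (nbrs G v)" by (auto simp: inj_on_def doubleton_eq_iff)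
    ultimately show ?thesis by (simp add: card_image)
  qed
  then have "(\<Sum>v\<in>verts G. card (nbrs G v)) = (\<Sum>v\<in>verts G. card {e \<in> edges G. v \<in> e})" by simp
  also have "\<dots> = 2 * card (edges G)"
  proof (rule sum_multicount)
    show "\<forall>e\<in>edges G. card {v \<in> verts G. v \<in> e} = 2"
    proof
      fix e assume "e \<in> edges G"
      then have "e \<subseteq> verts G" "card e = 2" using G by (auto simp: simple_graph_def)
      moreover from this have "{v \<in> verts G. v \<in> e} = e" by auto
      ultimately show "card {v \<in> verts G. v \<in> e} = 2" by simp
    qed
  qed (use G simple_graph_edges in \<open>auto simp: simple_graph_def\<close>)
  finally show ?thesis by (simp add: num_edges_def)
qed

text \<open>Split the vertices into \<open>v\<close>, its neighbourhood \<open>N\<close> and the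
  rest \<open>W\<close>. Degrees in \<open>W\<close> are at least \<open>d\<close>. The degrees in
  \<open>N\<close> are counted from the other end: \<open>v\<close> sends \<open>d\<close> edges
  into \<open>N\<close>, each vertex of \<open>T\<close> sends \<open>a - 1\<close> (inside
  \<open>T\<close>), and each vertex of \<open>W\<close> sends at least \<open>a\<close>.\<close>

lemma degree_sum_ge:
  assumes G: "simple_graph G" and v: "v \<in> verts G" and d: "card (nbrs G v) = d"
    and min: "\<And>u. u \<in> verts G \<Longrightarrow> d \<le> card (nbrs G u)"
    and common: "\<And>w. w \<in> verts G \<Longrightarrow> w \<noteq> v \<Longrightarrow> w \<notin> nbrs G v \<Longrightarrow> a \<le> card (nbrs G v \<inter> nbrs G w)"
    and T: "T \<subseteq> nbrs G v" "card T = a" "pairs T \<subseteq> edges G"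
  shows "2 * d + a * (a - 1) + (card (verts G) - 1 - d) * (a + d) \<le> 2 * num_edges G"
proof -
  let ?N = "nbrs G v" and ?V = "verts G"
  define W where "W = ?V - ?N - {v}"
  note simple = nbrs_simple[OF G]
  have finV: "finite ?V" using G by (simp add: simple_graph_def)
  have fin: "finite ?N" "finite T" "finite W"
    using simple(3)[of v] T(1) finV by (auto simp: W_def intro: finite_subset)
  have cardW: "card W = card ?V - 1 - d"
    using simple[of v] d v fin by (simp add: W_def card_Diff_subset)
  have V: "?V = insert v (?N \<union> W)" "v \<notin> ?N \<union> W" "?N \<inter> W = {}"
    using simple[of v] v by (auto simp: W_def)
  have "(\<Sum>u\<in>?N. card (nbrs G u)) = (\<Sum>u\<in>?N. card {x \<in> ?V. x \<in> nbrs G u})"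
    using simple(1) by (intro sum.cong refl arg_cong[where f = card]) auto
  \<comment> \<open>Exchanging the sums counts each incidence at its end outside the role of
    neighbour of \<open>v\<close>; afterwards the vertices of \<open>N - T\<close> are
    discarded.\<close>
  also have "\<dots> = (\<Sum>x\<in>?V. card {u \<in> ?N. x \<in> nbrs G u})"
    using finV fin by (intro sum_multicount_gen) auto
  also have "\<dots> \<ge> (\<Sum>x\<in>insert v (T \<union> W). card {u \<in> ?N. x \<in> nbrs G u})"
    using finV V T(1) by (intro sum_mono2) auto
  also have "(\<Sum>x\<in>insert v (T \<union> W). card {u \<in> ?N. x \<in> nbrs G u})
      = card {u \<in> ?N. v \<in> nbrs G u} + ((\<Sum>x\<in>T. card {u \<in> ?N. x \<in> nbrs G u})
        + (\<Sum>x\<in>W. card {u \<in> ?N. x \<in> nbrs G u}))"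
    using fin V T(1) by (subst sum.insert, simp, blast, subst sum.union_disjoint) auto
  also have "{u \<in> ?N. v \<in> nbrs G u} = ?N" by (auto simp: nbrs_sym[of v])
  finally have 1: "d + ((\<Sum>x\<in>T. card {u \<in> ?N. x \<in> nbrs G u})
        + (\<Sum>x\<in>W. card {u \<in> ?N. x \<in> nbrs G u})) \<le> (\<Sum>u\<in>?N. card (nbrs G u))" by (simp add: d)
  have "(\<Sum>x\<in>T. a - 1) \<le> (\<Sum>x\<in>T. card {u \<in> ?N. x \<in> nbrs G u})"
  proof (rule sum_mono)
    fix x assume x: "x \<in> T"
    have "T - {x} \<subseteq> {u \<in> ?N. x \<in> nbrs G u}"
    proof
      fix u assume u: "u \<in> T - {x}"
      then have "{u, x} \<in> pairs T" using x by simp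
      then show "u \<in> {u \<in> ?N. x \<in> nbrs G u}" using u T by (auto simp: nbrs_def)
    qed
    then have "card (T - {x}) \<le> card {u \<in> ?N. x \<in> nbrs G u}" using fin by (intro card_mono) auto
    then show "a - 1 \<le> card {u \<in> ?N. x \<in> nbrs G u}" using x T(2) fin by simp
  qed
  then have 2: "a * (a - 1) \<le> (\<Sum>x\<in>T. card {u \<in> ?N. x \<in> nbrs G u})" using T(2) by simp
  have "(\<Sum>x\<in>W. a) \<le> (\<Sum>x\<in>W. card {u \<in> ?N. x \<in> nbrs G u})"
  proof (rule sum_mono)
    fix w assume "w \<in> W"
    then have "a \<le> card (?N \<inter> nbrs G w)" using common by (simp add: W_def)
    also have "?N \<inter> nbrs G w = {u \<in> ?N. w \<in> nbrs G u}" by (auto simp: nbrs_sym[of w])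
    finally show "a \<le> card {u \<in> ?N. w \<in> nbrs G u}" .
  qed
  then have 3: "card W * a \<le> (\<Sum>x\<in>W. card {u \<in> ?N. x \<in> nbrs G u})" by simp
  have "(\<Sum>x\<in>W. d) \<le> (\<Sum>x\<in>W. card (nbrs G x))"
    using min by (intro sum_mono) (auto simp: W_def)
  then have 4: "card W * d \<le> (\<Sum>x\<in>W. card (nbrs G x))" by simp
  have "2 * num_edges G = (\<Sum>x\<in>insert v (?N \<union> W). card (nbrs G x))"
    using handshake[OF G] V(1) by simp
  also have "\<dots> = d + ((\<Sum>u\<in>?N. card (nbrs G u)) + (\<Sum>x\<in>W. card (nbrs G x)))"
    using fin V(2,3) d by (subst sum.insert, simp, blast, subst sum.union_disjoint) auto
  finally have "2 * num_edges G = d + ((\<Sum>u\<in>?N. card (nbrs G u)) + (\<Sum>x\<in>W. card (nbrs G x)))" .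
  then show ?thesis using 1 2 3 4 unfolding cardW[symmetric] add_mult_distrib2 by linarith
qed

section \<open>The lower bound\<close>

text \<open>\<open>T\<close> is what remains of the clique through the added edge once
  \<open>v\<close> and \<open>w\<close> are removed: all its vertices were already adjacent to both
  ends and to each other. The remaining cliques are disjoint from the whole new clique.\<close>

lemma saturated_common_nbrs:
  assumes sat: "saturated (clique_union ps) G" and vw: "v \<in> verts G" "w \<in> verts G" "v \<noteq> w"
    "w \<notin> nbrs G v"
  shows "\<exists>T i K. i < length ps \<and> T \<subseteq> nbrs G v \<inter> nbrs G w \<and> card T = ps ! i - 2 \<and> pairs T \<subseteq> edges G
    \<and> (\<forall>j<length ps. j \<noteq> i \<longrightarrow> K j \<subseteq> verts G - (T \<union> {v, w}) \<and> clique (edges G) (ps ! j) (K j))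
    \<and> (\<forall>j<length ps. \<forall>l<length ps. j \<noteq> l \<longrightarrow> K j \<inter> K l = {})"
proof -
  obtain K i where i: "i < length ps" "v \<in> K i" "w \<in> K i"
    and fam: "clique_family (add_edge G v w) ps K"
    and old: "\<And>j. j < length ps \<Longrightarrow> j \<noteq> i \<Longrightarrow> clique (edges G) (ps ! j) (K j)"
    using saturated_new_clique[OF sat vw(1-3)] vw(4) unfolding nbrs_def by blast
  note D = clique_familyD[OF fam]
  have cl: "clique (insert {v, w} (edges G)) (ps ! i) (K i)"
    using D(2)[OF i(1)] by (simp add: add_edge_def)
  define T where "T = K i - {v, w}"
  have new: "{x, y} \<in> edges G" if "x \<in> K i" "y \<in> K i" "x \<noteq> y" "{x, y} \<noteq> {v, w}" for x y
  proof -
    have "{x, y} \<in> pairs (K i)" using that by simp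
    then have "{x, y} \<in> insert {v, w} (edges G)" using cl unfolding clique_def by blast
    then show ?thesis using that(4) by blast
  qed
  have T1: "T \<subseteq> nbrs G v \<inter> nbrs G w"
    using i(2,3) new by (auto simp: T_def nbrs_def doubleton_eq_iff)
  have T2: "card T = ps ! i - 2"
    using cl i(2,3) vw(3) by (simp add: T_def clique_def card_Diff_subset)
  have T3: "pairs T \<subseteq> edges G"
  proof
    fix e assume "e \<in> pairs T"
    then obtain x y where "e = {x, y}" "x \<in> T" "y \<in> T" "x \<noteq> y" by (rule pairsE)
    then show "e \<in> edges G" using new[of x y] by (auto simp: T_def doubleton_eq_iff)
  qed
  have sub: "K j \<subseteq> verts G - (T \<union> {v, w})" if "j < length ps" "j \<noteq> i" for j
    using D(1)[OF that(1)] D(3)[OF that(1) i(1) that(2)] i(2,3) by (auto simp: T_def add_edge_def)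
  show ?thesis
    by (rule exI[of _ T], rule exI[of _ i], rule exI[of _ K])
      (intro conjI allI impI i(1) T1 T2 T3 sub old D(3))
qed

section \<open>Arithmetic for the degree bounds\<close>

lemma two_times_choose_two: "2 * (m choose 2) = m * (m - 1)" for m :: nat
proof -
  have "even (m * (m - 1))" by (cases m) auto
  then show ?thesis unfolding choose_two by (rule dvd_mult_div_cancel)
qed

lemma four_index: "i < 4 \<Longrightarrow> i = 0 \<or> i = 1 \<or> i = 2 \<or> i = (3::nat)"
  by auto

text \<open>Everything is doubled to avoid binomials: \<open>S\<close> will be twice the sum of the
  three \<open>(p_i + 1) choose 2\<close>. The slacks \<open>k\<close>, \<open>l\<close>,
  \<open>s\<close>, \<open>x\<close> turn the strict and weak inequalities into equations, leaving a
  comparison of polynomials over the naturals.\<close>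

lemma min_degree_case_arith:
  fixes a d n S e :: nat
  assumes "a < d" "d \<le> 2 * a" "3 * a + S < n" "a \<le> S"
    and "2 * d + a * (a - 1) + (n - 1 - d) * (a + d) \<le> 2 * e"
  shows "2 * (a * (n - a)) + a * (a - 1) + S \<le> 2 * e"
proof -
  define k where "k = d - a - 1"
  define l where "l = a - 1 - k"
  define s where "s = S - a"
  define x where "x = n - (3 * a + S + 1)"
  have k: "d = a + 1 + k" using assms(1) by (simp add: k_def)
  have l: "a = 1 + k + l" using assms(2) k by (simp add: l_def)
  have s: "S = a + s" using assms(4) by (simp add: s_def)
  have x: "n = 3 * a + S + 1 + x" using assms(3) by (simp add: x_def)
  have n1: "n - 1 - d = 2 * a + S + x - k - 1" "n - a = 2 * a + S + 1 + x"
    using k l x by auto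
  then have n2: "n - 1 - d = 2 + k + 2 * l + S + x - 1" using l by simp
  have "2 * (a * (n - a)) + S \<le> 2 * d + (n - 1 - d) * (a + d)"
    unfolding n1(2) n2 unfolding k s by (simp add: l algebra_simps)
  with assms(5) show ?thesis by linarith
qed

context
  fixes p1 p2 p3 p4 n :: nat and G :: "'a graph"
  assumes p: "4 \<le> p1" "p1 \<le> p2" "p2 + p1 \<le> p3" "p3 + p1 \<le> p4"
    and n: "3 * (p1 - 2) + (p2 * (p2 + 1) + p3 * (p3 + 1) + p4 * (p4 + 1)) < n"
    and sat: "saturated (clique_union [p1, p2, p3, p4]) G" and card_verts: "card (verts G) = n"
begin

lemma saturated_simple: "simple_graph G"
  using sat by (simp add: saturated_def)

lemma saturated_finite_verts: "finite (verts G)"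
  using saturated_simple by (simp add: simple_graph_def)

text \<open>The clique created by adding \<open>vw\<close> has all its other vertices in the
  neighbourhood of \<open>v\<close>, which has only \<open>p1 - 2\<close> elements. So its order is
  \<open>p1\<close> and it uses the entire neighbourhood; the other three cliques have orders
  \<open>p2\<close>, \<open>p3\<close>, \<open>p4\<close>.\<close>

lemma min_degree_core:
  assumes v: "v \<in> verts G" and d: "card (nbrs G v) = p1 - 2"
    and w: "w \<in> verts G" "w \<noteq> v" "w \<notin> nbrs G v"
  shows "nbrs G v \<subseteq> nbrs G w" "pairs (nbrs G v) \<subseteq> edges G"
    "\<exists>P Q R. clique (edges G) p2 P \<and> clique (edges G) p3 Q \<and> clique (edges G) p4 R
      \<and> P \<inter> Q = {} \<and> P \<inter> R = {} \<and> Q \<inter> R = {} \<and> P \<union> Q \<union> R \<subseteq> verts G - nbrs G v - {v, w}"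
proof -
  let ?ps = "[p1, p2, p3, p4]"
  have len: "length ?ps = 4" by simp
  obtain T i K where i: "i < 4" and T: "T \<subseteq> nbrs G v \<inter> nbrs G w" "card T = ?ps ! i - 2" "pairs T \<subseteq> edges G"
    and K': "\<forall>j<4. j \<noteq> i \<longrightarrow> K j \<subseteq> verts G - (T \<union> {v, w}) \<and> clique (edges G) (?ps ! j) (K j)"
    and dis': "\<forall>j<4. \<forall>l<4. j \<noteq> l \<longrightarrow> K j \<inter> K l = {}"
    using saturated_common_nbrs[OF sat v w(1) w(2)[symmetric] w(3)] unfolding len
    by (elim exE conjE)
  note K = K'[rule_format] and dis = dis'[rule_format]
  \<comment> \<open>If \<open>p2 = p1\<close>, the new clique may be the one indexed by \<open>1\<close>; then \<open>K 0\<close> replaces it.\<close>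
  have ge: "p1 \<le> ?ps ! i" using four_index[OF i] p by auto
  have le: "card T \<le> p1 - 2"
    using T(1) d card_mono[OF nbrs_simple(3)[OF saturated_simple], of T v] by simp
  then have eq: "?ps ! i = p1" using ge T(2) p by simp
  then have TN: "T = nbrs G v"
    using T(1,2) d by (intro card_subset_eq nbrs_simple(3)[OF saturated_simple]) auto
  show "nbrs G v \<subseteq> nbrs G w" "pairs (nbrs G v) \<subseteq> edges G" using T TN by auto
  have "i = 0 \<or> i = 1" using four_index[OF i] eq p by auto
  \<comment> \<open>\<open>1 - i\<close> is the other one of the indices 0 and 1.\<close>
  define P where "P = K (1 - i)"
  have i01: "1 - i < 4" "1 - i \<noteq> i" "2 \<noteq> i" "3 \<noteq> i" "?ps ! (1 - i) = p2" "1 - i \<noteq> 2" "1 - i \<noteq> 3"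
    using \<open>i = 0 \<or> i = 1\<close> eq by auto
  have "clique (edges G) p2 P \<and> P \<subseteq> verts G - (T \<union> {v, w})" using K[OF i01(1,2)] i01(5) by (simp add: P_def)
  moreover have "clique (edges G) p3 (K 2) \<and> K 2 \<subseteq> verts G - (T \<union> {v, w})" using K[of 2] i01(3) by simp
  moreover have "clique (edges G) p4 (K 3) \<and> K 3 \<subseteq> verts G - (T \<union> {v, w})" using K[of 3] i01(4) by simp
  moreover have "P \<inter> K 2 = {}" "P \<inter> K 3 = {}" "K 2 \<inter> K 3 = {}"
    using dis[of "1 - i" 2] dis[of "1 - i" 3] dis[of 2 3] i01 by (simp_all add: P_def)
  ultimately show "\<exists>P Q R. clique (edges G) p2 P \<and> clique (edges G) p3 Q \<and> clique (edges G) p4 R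
      \<and> P \<inter> Q = {} \<and> P \<inter> R = {} \<and> Q \<inter> R = {} \<and> P \<union> Q \<union> R \<subseteq> verts G - nbrs G v - {v, w}"
    unfolding TN by blast
qed

text \<open>Three disjoint sets of edges are counted: inside \<open>C\<close>, between
  \<open>C\<close> and the rest, and outside \<open>C\<close>, where
  \<open>card_edges_ge_three\<close> applies.\<close>

lemma edges_ge_if_min_degree:
  assumes v: "v \<in> verts G" and d: "card (nbrs G v) = p1 - 2"
  shows "(p1 - 2) * (n - (p1 - 2)) + ((p1 - 2) choose 2)
      + (((p2 + 1) choose 2) + ((p3 + 1) choose 2) + ((p4 + 1) choose 2)) \<le> num_edges G"
proof -
  define C where "C = nbrs G v"
  define E where "E = edges G \<inter> pairs (verts G - C)"
  have finC: "finite C" "C \<subseteq> verts G" "v \<notin> C" using nbrs_simple[OF saturated_simple, of v] by (auto simp: C_def)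
  have finE: "finite (edges G)" by (rule simple_graph_edges(2)[OF saturated_simple])
  have "card (insert v C) < card (verts G)"
    using finC d n p card_verts by (simp add: C_def)
  then have "\<not> verts G \<subseteq> insert v C" using finC by (metis card_mono finite_insert linorder_not_less)
  then obtain w0 where w0: "w0 \<in> verts G" "w0 \<noteq> v" "w0 \<notin> C" by blast
  have CE: "pairs C \<subseteq> edges G" using min_degree_core(2)[OF v d] w0 by (simp add: C_def)
  have "between C (verts G - C) \<subseteq> edges G"
  proof
    fix e assume "e \<in> between C (verts G - C)"
    then obtain x y where e: "e = {x, y}" "x \<in> C" "y \<in> verts G" "y \<notin> C" by (auto simp: between_def)
    have "x \<in> nbrs G y"
      using min_degree_core(1)[OF v d, of y] e by (cases "y = v") (auto simp: C_def)
    then show "e \<in> edges G" using e by (simp add: nbrs_def insert_commute)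
  qed
  moreover have "((p2 + 1) choose 2) + ((p3 + 1) choose 2) + ((p4 + 1) choose 2) \<le> card E"
  proof (rule card_edges_ge_three)
    fix w
    \<comment> \<open>The cliques always lie outside \<open>C\<close> and avoid \<open>v\<close>. If
      \<open>w\<close> is in \<open>C\<close>, equals \<open>v\<close> or is no vertex at all, it is
      avoided anyway, and \<open>w0\<close> serves as the nonneighbour to connect to
      \<open>v\<close>.\<close>
    define w' where "w' = (if w \<in> verts G - C - {v} then w else w0)"
    have w': "w' \<in> verts G" "w' \<noteq> v" "w' \<notin> nbrs G v" using w0 by (auto simp: w'_def C_def)
    obtain P Q R where c: "clique (edges G) p2 P" "clique (edges G) p3 Q" "clique (edges G) p4 R"
      "P \<inter> Q = {}" "P \<inter> R = {}" "Q \<inter> R = {}" "P \<union> Q \<union> R \<subseteq> verts G - C - {v, w'}"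
      using min_degree_core(3)[OF v d w'] unfolding C_def by blast
    have restrict: "clique E k K" if "clique (edges G) k K" "K \<subseteq> verts G - C" for k K
      using that(1) pairs_mono[OF that(2)] by (simp add: clique_def E_def)
    have "clique E p2 P" using c(7) by (intro restrict c(1)) blast
    moreover have "clique E p3 Q" using c(7) by (intro restrict c(2)) blast
    moreover have "clique E p4 R" using c(7) by (intro restrict c(3)) blast
    moreover have "w \<notin> P \<union> Q \<union> R" using c(7) by (auto simp: w'_def split: if_splits)
    ultimately show "\<exists>P Q R. clique E p2 P \<and> clique E p3 Q \<and> clique E p4 R
      \<and> P \<inter> Q = {} \<and> P \<inter> R = {} \<and> Q \<inter> R = {} \<and> w \<notin> P \<union> Q \<union> R"
      using c(4-6) by blast
  qed (use p finE in \<open>auto simp: E_def\<close>)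
  moreover have "card (pairs C \<union> between C (verts G - C) \<union> E) = card (pairs C) + card (between C (verts G - C)) + card E"
  proof -
    have "pairs C \<inter> between C (verts G - C) = {}" by (auto simp: pairs_def between_def)
    moreover have "(pairs C \<union> between C (verts G - C)) \<inter> E = {}"
      by (auto simp: E_def between_def doubleton_eq_iff elim!: pairsE)
    moreover have "finite (between C (verts G - C))"
      using finC saturated_finite_verts by (simp add: between_def)
    ultimately show ?thesis using finC finE by (simp add: card_Un_disjoint E_def)
  qed
  moreover have "card (between C (verts G - C)) = (p1 - 2) * (n - (p1 - 2))"
    using finC saturated_finite_verts d card_verts by (subst card_between) (auto simp: C_def card_Diff_subset)
  moreover have "card (pairs C) = (p1 - 2) choose 2" using finC d by (simp add: card_pairs C_def)
  ultimately show ?thesis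
    using card_mono[OF finE, of "pairs C \<union> between C (verts G - C) \<union> E"] CE
    by (simp add: num_edges_def E_def)
qed

text \<open>Compare the minimum degree \<open>d\<close> with \<open>a = p1 - 2\<close>. Above
  \<open>2 * a\<close>, the handshake identity suffices. Common neighbours with a nonneighbour rule
  out \<open>d < a\<close>. For \<open>a < d \<le> 2 * a\<close> the bound
  \<open>degree_sum_ge\<close> is enough, and \<open>d = a\<close> is the structural case.\<close>

lemma saturated_edges_ge:
  "(p1 - 2) * (n - (p1 - 2)) + ((p1 - 2) choose 2)
      + (((p2 + 1) choose 2) + ((p3 + 1) choose 2) + ((p4 + 1) choose 2)) \<le> num_edges G"
proof -
  define a where "a = p1 - 2"
  define S where "S = p2 * (p2 + 1) + p3 * (p3 + 1) + p4 * (p4 + 1)"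
  have n': "3 * a + S < n" using n by (simp add: a_def S_def)
  have a2: "2 \<le> a" using p by (simp add: a_def)
  have "a \<le> p2" using p by (simp add: a_def)
  also have "p2 \<le> S" by (simp add: S_def)
  finally have aS: "a \<le> S" .
  have goal: ?thesis if "2 * (a * (n - a)) + a * (a - 1) + S \<le> 2 * num_edges G"
    using that two_times_choose_two[of a] two_times_choose_two[of "p2 + 1"]
      two_times_choose_two[of "p3 + 1"] two_times_choose_two[of "p4 + 1"]
    by (simp add: a_def[symmetric] S_def mult.commute)
  have "verts G \<noteq> {}" using card_verts n by auto
  then obtain v where v: "v \<in> verts G" and min: "\<And>u. u \<in> verts G \<Longrightarrow> card (nbrs G v) \<le> card (nbrs G u)"
    using saturated_finite_verts ex_min_if_finite[of "(\<lambda>u. card (nbrs G u)) ` verts G"] by (auto simp: not_less)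
  define d where "d = card (nbrs G v)"
  show ?thesis
  proof (cases "2 * a < d")
    case True
    have "(\<Sum>u\<in>verts G. 2 * a + 1) \<le> (\<Sum>u\<in>verts G. card (nbrs G u))"
      using min True by (intro sum_mono) (fastforce simp: d_def)
    then have "n * (2 * a + 1) \<le> 2 * num_edges G" using handshake[OF saturated_simple] card_verts by simp
    moreover define x where "x = n - (3 * a + S)"
    then have "n = 3 * a + S + x" using n' by simp
    ultimately show ?thesis by (intro goal) (cases a, auto simp: algebra_simps)
  next
    case False
    have common: "\<exists>T. T \<subseteq> nbrs G v \<inter> nbrs G w \<and> card T = a \<and> pairs T \<subseteq> edges G"
      if w: "w \<in> verts G" "w \<noteq> v" "w \<notin> nbrs G v" for w
    proof -
      have len: "length [p1, p2, p3, p4] = 4" by simp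
      obtain T i where i: "i < 4" and T: "T \<subseteq> nbrs G v \<inter> nbrs G w" "card T = [p1, p2, p3, p4] ! i - 2"
        "pairs T \<subseteq> edges G"
        using saturated_common_nbrs[OF sat v w(1) w(2)[symmetric] w(3)] unfolding len
        by (elim exE conjE)
      \<comment> \<open>Whichever clique uses the new edge, its order is at least \<open>p1\<close>,
        so an \<open>a\<close>-subset of \<open>T\<close> can be taken.\<close>
      have "a \<le> card T" using four_index[OF i] p T(2) by (auto simp: a_def)
      then obtain T' where T': "T' \<subseteq> T" "card T' = a" by (meson obtain_subset_with_card_n)
      then show ?thesis using T pairs_mono[OF T'(1)] by (intro exI[of _ T']) auto
    qed
    have "card (insert v (nbrs G v)) < card (verts G)"
      using False n' a2 nbrs_simple[OF saturated_simple, of v] card_verts by (simp add: d_def)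
    then have "\<not> verts G \<subseteq> insert v (nbrs G v)"
      using nbrs_simple(3)[OF saturated_simple] by (metis card_mono finite_insert linorder_not_less)
    then obtain w0 where w0: "w0 \<in> verts G" "w0 \<noteq> v" "w0 \<notin> nbrs G v" by blast
    obtain T where T: "T \<subseteq> nbrs G v" "card T = a" "pairs T \<subseteq> edges G"
      using common[OF w0] by blast
    then have "a \<le> d" using card_mono[OF nbrs_simple(3)[OF saturated_simple] T(1)] by (simp add: d_def)
    show ?thesis
    proof (cases "d = a")
      case True
      then show ?thesis using edges_ge_if_min_degree[OF v] by (simp add: d_def a_def)
    next
      case neq: False
      have "2 * d + a * (a - 1) + (card (verts G) - 1 - d) * (a + d) \<le> 2 * num_edges G"
      proof (rule degree_sum_ge[OF saturated_simple v _ _ _ T])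
        show "a \<le> card (nbrs G v \<inter> nbrs G w)" if "w \<in> verts G" "w \<noteq> v" "w \<notin> nbrs G v" for w
          using common[OF that] nbrs_simple(3)[OF saturated_simple] by (metis card_mono finite_Int)
      qed (use min in \<open>auto simp: d_def\<close>)
      then show ?thesis
        using neq False \<open>a \<le> d\<close> n' aS card_verts by (intro goal min_degree_case_arith[of a d]) auto
    qed
  qed
qed

end

section \<open>The extremal graph\<close>

text \<open>The graph \<open>H(n; p1, p2, p3, p4)\<close> over an arbitrary vertex type:
  \<open>C\<close> is the joined clique, and vertices in none of the four parts form the edgeless
  part. It is instantiated both at the tagged vertices of \<open>H_graph\<close> and at the natural
  numbers over which \<open>sat\<close> ranges.\<close>

definition core_graph :: "'a set \<Rightarrow> 'a set \<Rightarrow> 'a set \<Rightarrow> 'a set \<Rightarrow> 'a set \<Rightarrow> 'a graph" where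
  "core_graph V C B2 B3 B4 =
     Graph V (pairs C \<union> between C (V - C) \<union> pairs B2 \<union> pairs B3 \<union> pairs B4)"

locale core_structure =
  fixes V C B2 B3 B4 :: "'a set" and p1 p2 p3 p4 n :: nat
  assumes finite_V: "finite V"
    and subsets: "C \<subseteq> V" "B2 \<subseteq> V" "B3 \<subseteq> V" "B4 \<subseteq> V"
    and disjoint: "C \<inter> B2 = {}" "C \<inter> B3 = {}" "C \<inter> B4 = {}"
      "B2 \<inter> B3 = {}" "B2 \<inter> B4 = {}" "B3 \<inter> B4 = {}"
    and cards: "card V = n" "card C = p1 - 2" "card B2 = p2 + 1" "card B3 = p3 + 1" "card B4 = p4 + 1"
    and order: "2 \<le> p1" "p1 \<le> p2" "p2 + p1 \<le> p3" "p3 + p1 \<le> p4"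
begin

abbreviation "G \<equiv> core_graph V C B2 B3 B4"

lemma verts_G [simp]: "verts G = V"
  by (simp add: core_graph_def)

lemma adjacent_iff:
  assumes "x \<in> V" "y \<in> V" "x \<noteq> y"
  shows "{x, y} \<in> edges G \<longleftrightarrow> x \<in> C \<or> y \<in> C \<or> (\<exists>B\<in>{B2, B3, B4}. x \<in> B \<and> y \<in> B)"
  using assms by (auto simp: core_graph_def between_def doubleton_eq_iff)

lemma finite_parts: "finite C" "finite B2" "finite B3" "finite B4"
  using finite_V subsets by (auto intro: finite_subset)

lemma edges_in_pairs: "edges G \<subseteq> pairs V"
proof -
  have "between C (V - C) \<subseteq> pairs V" using subsets(1) by (auto simp: between_def)
  with subsets[THEN pairs_mono] show ?thesis by (simp add: core_graph_def)
qed

lemma simple_G: "simple_graph G"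
  using edges_in_pairs finite_V by (auto simp: simple_graph_def pairs_def)

text \<open>\<open>C\<close> has only \<open>p1 - 2\<close> vertices, so \<open>K\<close> has two
  outside it. Adjacent vertices outside \<open>C\<close> share a block, and the blocks are disjoint,
  so one block holds all of \<open>K - C\<close>.\<close>

lemma clique_location:
  assumes K: "clique (edges G) k K" "K \<subseteq> V" "p1 \<le> k"
  shows "K \<subseteq> C \<union> B2 \<or> K \<subseteq> C \<union> B3 \<or> K \<subseteq> C \<union> B4"
proof -
  have fin: "finite K" "card K = k" "pairs K \<subseteq> edges G" using K(1) by (auto simp: clique_def)
  have "card K - card C \<le> card (K - C)" by (rule diff_card_le_card_Diff[OF finite_parts(1)])
  then have "Suc 1 \<le> card (K - C)" using fin K(3) cards order by simp
  then obtain x y where xy: "x \<in> K - C" "y \<in> K - C" "x \<noteq> y"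
    by (metis card_le_Suc0_iff_eq fin(1) finite_Diff not_less_eq_eq One_nat_def)
  have adj: "\<exists>B\<in>{B2, B3, B4}. x \<in> B \<and> z \<in> B" if "z \<in> K - C" "z \<noteq> x" for z
  proof -
    have "{x, z} \<in> pairs K" using that xy by simp
    then have "{x, z} \<in> edges G" using fin(3) by blast
    then show ?thesis using adjacent_iff[of x z] that xy(1) K(2) by auto
  qed
  from adj[of y] xy obtain B where B: "B \<in> {B2, B3, B4}" "x \<in> B" by blast
  have "z \<in> B" if "z \<in> K - C" for z
  proof (cases "z = x")
    case False
    from adj[OF that False] obtain B' where B': "B' \<in> {B2, B3, B4}" "x \<in> B'" "z \<in> B'" by blast
    then have "B' = B" using B disjoint by blast
    with B' show ?thesis by simp
  qed (use B in simp)
  then have "K \<subseteq> C \<union> B" by blast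
  with B show ?thesis by blast
qed

lemma card_core_Un: "card (C \<union> B2) = p1 + p2 - 1" "card (C \<union> B3) = p1 + p3 - 1" "card (C \<union> B4) = p1 + p4 - 1"
  using finite_parts disjoint cards order by (simp_all add: card_Un_disjoint)

lemma disjoint_cliques_card:
  assumes "clique E k K" "clique E l L" "K \<inter> L = {}" "K \<subseteq> X" "L \<subseteq> X" "finite X"
  shows "k + l \<le> card X"
proof -
  have "k + l = card (K \<union> L)" using assms by (simp add: clique_def card_Un_disjoint)
  also have "\<dots> \<le> card X" using assms by (intro card_mono) auto
  finally show ?thesis .
qed

lemma clique_card: "clique E k K \<Longrightarrow> K \<subseteq> X \<Longrightarrow> finite X \<Longrightarrow> k \<le> card X"
  by (auto simp: clique_def intro: card_mono)

text \<open>Place the cliques from the largest down. By the gaps, the third and fourth do not fit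
  into \<open>C\<close> together with a smaller block. Once \<open>C \<union> B_i\<close> hosts a
  clique of order \<open>p_i\<close>, fewer than \<open>p1\<close> of its
  \<open>p1 + p_i - 1\<close> vertices are left, so no other clique fits. This forces one clique per
  block and leaves no place for the first.\<close>

lemma no_copy: "\<not> contains_copy G (clique_union [p1, p2, p3, p4])"
proof
  assume "contains_copy G (clique_union [p1, p2, p3, p4])"
  then obtain K where fam: "clique_family G [p1, p2, p3, p4] K"
    using contains_copy_clique_unionD by blast
  note D = clique_familyD[OF fam]
  have cl: "clique (edges G) p1 (K 0)" "clique (edges G) p2 (K 1)" "clique (edges G) p3 (K 2)"
    "clique (edges G) p4 (K 3)"
    using D(2)[of 0] D(2)[of 1] D(2)[of 2] D(2)[of 3] by simp_all
  have sub: "K 0 \<subseteq> V" "K 1 \<subseteq> V" "K 2 \<subseteq> V" "K 3 \<subseteq> V"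
    using D(1)[of 0] D(1)[of 1] D(1)[of 2] D(1)[of 3] by simp_all
  have dis: "K 0 \<inter> K 1 = {}" "K 0 \<inter> K 2 = {}" "K 0 \<inter> K 3 = {}" "K 1 \<inter> K 2 = {}" "K 1 \<inter> K 3 = {}"
    "K 2 \<inter> K 3 = {}"
    using D(3)[of 0 1] D(3)[of 0 2] D(3)[of 0 3] D(3)[of 1 2] D(3)[of 1 3] D(3)[of 2 3] by simp_all
  have fin: "finite (C \<union> B2)" "finite (C \<union> B3)" "finite (C \<union> B4)" using finite_parts by auto
  note small = clique_card[OF _ _ fin(1)] clique_card[OF _ _ fin(2)] clique_card[OF _ _ fin(3)]
  note two = disjoint_cliques_card[OF _ _ _ _ _ fin(1)] disjoint_cliques_card[OF _ _ _ _ _ fin(2)]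
    disjoint_cliques_card[OF _ _ _ _ _ fin(3)]
  have "\<not> K 3 \<subseteq> C \<union> B2" "\<not> K 3 \<subseteq> C \<union> B3"
    using small(1,2)[OF cl(4)] order by (auto simp: card_core_Un)
  then have 3: "K 3 \<subseteq> C \<union> B4" using clique_location[OF cl(4) sub(4)] order by auto
  have "\<not> K 2 \<subseteq> C \<union> B2" "\<not> K 2 \<subseteq> C \<union> B4"
    using small(1)[OF cl(3)] two(3)[OF cl(3,4) dis(6) _ 3] order by (auto simp: card_core_Un)
  then have 2: "K 2 \<subseteq> C \<union> B3" using clique_location[OF cl(3) sub(3)] order by auto
  have "\<not> K 1 \<subseteq> C \<union> B3" "\<not> K 1 \<subseteq> C \<union> B4"
    using two(2)[OF cl(2,3) dis(4) _ 2] two(3)[OF cl(2,4) dis(5) _ 3] order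
    by (auto simp: card_core_Un)
  then have 1: "K 1 \<subseteq> C \<union> B2" using clique_location[OF cl(2) sub(2)] order by auto
  have "\<not> K 0 \<subseteq> C \<union> B2" "\<not> K 0 \<subseteq> C \<union> B3" "\<not> K 0 \<subseteq> C \<union> B4"
    using two(1)[OF cl(1,2) dis(1) _ 1] two(2)[OF cl(1,3) dis(2) _ 2] two(3)[OF cl(1,4) dis(3) _ 3] order
    by (auto simp: card_core_Un)
  then show False using clique_location[OF cl(1) sub(1)] by auto
qed

text \<open>The new edge completes \<open>C \<union> {u, v}\<close> to a clique of order
  \<open>p1\<close>. Each block has one vertex to spare and contains at most one of the two
  nonadjacent ends, so it still supplies its clique.\<close>

lemma copy_after_adding:
  assumes uv: "u \<in> V" "v \<in> V" "u \<noteq> v" "{u, v} \<notin> edges G"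
  shows "contains_copy (add_edge G u v) (clique_union [p1, p2, p3, p4])"
proof -
  have nonadj: "u \<notin> C" "v \<notin> C" "\<And>B. B \<in> {B2, B3, B4} \<Longrightarrow> \<not> (u \<in> B \<and> v \<in> B)"
    using uv adjacent_iff[of u v] by auto
  have ex: "\<exists>K \<subseteq> B - {u, v}. card K = k"
    if "B \<in> {B2, B3, B4}" "finite B" "card B = k + 1" for B k
  proof -
    have "card (B \<inter> {u, v}) \<le> 1"
      using nonadj(3)[OF that(1)] by (cases "u \<in> B"; cases "v \<in> B") auto
    then have "k \<le> card (B - {u, v})" using that card_Int_Diff_eq[of B "{u, v}"] by simp
    then show ?thesis by (meson obtain_subset_with_card_n)
  qed
  obtain K2 where K2: "K2 \<subseteq> B2 - {u, v}" "card K2 = p2" using ex[of B2 p2] finite_parts cards by auto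
  obtain K3 where K3: "K3 \<subseteq> B3 - {u, v}" "card K3 = p3" using ex[of B3 p3] finite_parts cards by auto
  obtain K4 where K4: "K4 \<subseteq> B4 - {u, v}" "card K4 = p4" using ex[of B4 p4] finite_parts cards by auto
  define K1 where "K1 = C \<union> {u, v}"
  have E: "edges (add_edge G u v) = insert {u, v} (edges G)" by (simp add: add_edge_def)
  have "pairs K1 \<subseteq> insert {u, v} (edges G)"
  proof
    fix e assume "e \<in> pairs K1"
    then obtain x y where xy: "e = {x, y}" "x \<in> K1" "y \<in> K1" "x \<noteq> y" by (rule pairsE)
    show "e \<in> insert {u, v} (edges G)"
    proof (cases "x \<in> C \<or> y \<in> C")
      case True
      then show ?thesis using xy adjacent_iff[of x y] subsets(1) uv(1,2) by (auto simp: K1_def)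
    next
      case False
      then show ?thesis using xy by (auto simp: K1_def)
    qed
  qed
  then have 1: "clique (insert {u, v} (edges G)) p1 K1"
    using nonadj uv finite_parts cards order by (simp add: clique_def K1_def)
  have rest: "clique (insert {u, v} (edges G)) k K"
    if "K \<subseteq> B - {u, v}" "card K = k" "finite B" "pairs B \<subseteq> edges G" for K B k
    using that pairs_mono[of K B] finite_subset[of K B] by (auto simp: clique_def)
  have 2: "clique (insert {u, v} (edges G)) p2 K2"
    using rest[OF K2 finite_parts(2)] by (auto simp: core_graph_def)
  have 3: "clique (insert {u, v} (edges G)) p3 K3"
    using rest[OF K3 finite_parts(3)] by (auto simp: core_graph_def)
  have 4: "clique (insert {u, v} (edges G)) p4 K4"
    using rest[OF K4 finite_parts(4)] by (auto simp: core_graph_def)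
  have sub: "K1 \<subseteq> V" "K2 \<subseteq> V" "K3 \<subseteq> V" "K4 \<subseteq> V"
    using K2 K3 K4 subsets uv by (auto simp: K1_def)
  have dis: "K1 \<inter> K2 = {}" "K1 \<inter> K3 = {}" "K1 \<inter> K4 = {}" "K2 \<inter> K3 = {}" "K2 \<inter> K4 = {}" "K3 \<inter> K4 = {}"
    using K2(1) K3(1) K4(1) disjoint by (auto simp: K1_def)
  then have dis': "K2 \<inter> K1 = {}" "K3 \<inter> K1 = {}" "K4 \<inter> K1 = {}" "K3 \<inter> K2 = {}" "K4 \<inter> K2 = {}" "K4 \<inter> K3 = {}"
    by blast+
  have "clique_family (add_edge G u v) [p1, p2, p3, p4] ((!) [K1, K2, K3, K4])"
    unfolding clique_family_def E
    using 1 2 3 4 sub dis dis'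
    by (simp add: All_less_Suc add_edge_def)
  then show ?thesis by (rule contains_copy_clique_unionI)
qed

lemma saturated_G: "saturated (clique_union [p1, p2, p3, p4]) G"
  unfolding saturated_def using simple_G no_copy copy_after_adding by simp

lemma num_edges_G: "num_edges G = (p1 - 2) * (n - (p1 - 2)) + ((p1 - 2) choose 2)
      + (((p2 + 1) choose 2) + ((p3 + 1) choose 2) + ((p4 + 1) choose 2))"
proof -
  have fin: "finite (between C (V - C))" using finite_parts finite_V by (simp add: between_def)
  have b: "e \<inter> C \<noteq> {} \<and> \<not> e \<subseteq> C" if "e \<in> between C (V - C)" for e
    using that by (auto simp: between_def)
  have "pairs C \<inter> between C (V - C) = {}" using b by (auto simp: pairs_def)
  moreover have "(pairs C \<union> between C (V - C)) \<inter> pairs B = {}" if "finite B" "C \<inter> B = {}" for B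
    using b pairs_disjoint[of B C] that by (auto simp: pairs_def Int_commute)
  moreover have "pairs B2 \<inter> pairs B3 = {}" "pairs B2 \<inter> pairs B4 = {}" "pairs B3 \<inter> pairs B4 = {}"
    using disjoint finite_parts by (intro pairs_disjoint; simp)+
  ultimately have "num_edges G = card (pairs C) + card (between C (V - C)) + card (pairs B2)
      + card (pairs B3) + card (pairs B4)"
    using finite_parts fin disjoint
    by (simp add: num_edges_def core_graph_def card_Un_disjoint Int_Un_distrib2)
  moreover have "card (between C (V - C)) = (p1 - 2) * (n - (p1 - 2))"
    using finite_parts finite_V cards subsets by (subst card_between) (auto simp: card_Diff_subset)
  ultimately show ?thesis using finite_parts cards by (simp add: card_pairs)
qed

end

section \<open>Realising the core graph by \<open>H_graph\<close> and on natural numbers\<close>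

lemma edges_complete_graph: "edges (complete_graph m) = pairs {..<m}"
  by (simp add: complete_graph_def pairs_def)

lemma image_image_pairs:
  "(`) Inr ` (`) (Pair i) ` pairs A = pairs (Inr ` Pair i ` A)"
  by (simp add: image_pairs inj_on_def)

text \<open>The tags identify the parts: \<open>Inl\<close> marks the core, \<open>Inr\<close> with
  index 0, 1, 2 the three cliques, and index 3 the edgeless part.\<close>

lemma H_graph_eq_core_graph:
  fixes p1 p2 p3 p4 n :: nat
  defines "C \<equiv> Inl ` {..<p1 - 2}" and "B2 \<equiv> Inr ` Pair 0 ` {..<p2 + 1}"
    and "B3 \<equiv> Inr ` Pair 1 ` {..<p3 + 1}" and "B4 \<equiv> Inr ` Pair 2 ` {..<p4 + 1}"
    and "I \<equiv> Inr ` Pair 3 ` {..<n + 3 - (4 + (p1 + p2 + p3 + p4))}"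
  shows "H_graph n [p1, p2, p3, p4] = core_graph (C \<union> B2 \<union> B3 \<union> B4 \<union> I) C B2 B3 B4"
proof -
  let ?U = "disjoint_union [complete_graph (p2 + 1), complete_graph (p3 + 1), complete_graph (p4 + 1),
      edgeless_graph (n + 3 - (4 + (p1 + p2 + p3 + p4)))]"
  have H: "H_graph n [p1, p2, p3, p4] = graph_join (complete_graph (p1 - 2)) ?U"
    by (simp add: H_graph_def add.assoc)
  have V: "Inr ` verts ?U = B2 \<union> B3 \<union> B4 \<union> I"
    by (simp add: disjoint_union_def lessThan_Suc complete_graph_def edgeless_graph_def image_Un
        B2_def B3_def B4_def I_def numeral_2_eq_2 numeral_3_eq_3 Un_ac)
  have E: "(`) Inr ` edges ?U = pairs B2 \<union> pairs B3 \<union> pairs B4"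
    by (simp add: disjoint_union_def lessThan_Suc edges_complete_graph edgeless_graph_def image_Un
        image_image_pairs B2_def B3_def B4_def numeral_2_eq_2 Un_ac)
  have C: "Inl ` verts (complete_graph (p1 - 2)) = C" "(`) Inl ` edges (complete_graph (p1 - 2)) = pairs C"
    by (simp_all add: complete_graph_def[THEN arg_cong[where f = verts]] edges_complete_graph image_pairs C_def)
  have X: "{{Inl u, Inr v} |u v. u \<in> verts (complete_graph (p1 - 2)) \<and> v \<in> verts ?U}
      = between C (B2 \<union> B3 \<union> B4 \<union> I)"
    unfolding C(1)[symmetric] V[symmetric] between_def by auto
  have Y: "C \<union> B2 \<union> B3 \<union> B4 \<union> I - C = B2 \<union> B3 \<union> B4 \<union> I"
    by (auto simp: C_def B2_def B3_def B4_def I_def)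
  show ?thesis
    unfolding H graph_join_def C E V X core_graph_def Y by (simp only: Un_ac)
qed

lemma core_structure_H_graph:
  fixes p1 p2 p3 p4 n :: nat
  assumes p: "2 \<le> p1" "p1 \<le> p2" "p2 + p1 \<le> p3" "p3 + p1 \<le> p4" and n: "p1 + p2 + p3 + p4 < n"
  shows "\<exists>V C B2 B3 B4. core_structure V C B2 B3 B4 p1 p2 p3 p4 n
    \<and> H_graph n [p1, p2, p3, p4] = core_graph V C B2 B3 B4"
proof -
  define C :: "(nat + nat \<times> nat) set" where "C = Inl ` {..<p1 - 2}"
  define B2 :: "(nat + nat \<times> nat) set" where "B2 = Inr ` Pair 0 ` {..<p2 + 1}"
  define B3 :: "(nat + nat \<times> nat) set" where "B3 = Inr ` Pair 1 ` {..<p3 + 1}"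
  define B4 :: "(nat + nat \<times> nat) set" where "B4 = Inr ` Pair 2 ` {..<p4 + 1}"
  define I :: "(nat + nat \<times> nat) set" where "I = Inr ` Pair 3 ` {..<n + 3 - (4 + (p1 + p2 + p3 + p4))}"
  note defs = C_def B2_def B3_def B4_def I_def
  have fin: "finite C" "finite B2" "finite B3" "finite B4" "finite I" by (auto simp: defs)
  have disj: "C \<inter> B2 = {}" "C \<inter> B3 = {}" "C \<inter> B4 = {}" "C \<inter> I = {}" "B2 \<inter> B3 = {}" "B2 \<inter> B4 = {}"
    "B2 \<inter> I = {}" "B3 \<inter> B4 = {}" "B3 \<inter> I = {}" "B4 \<inter> I = {}"
    by (auto simp: defs)
  have cards: "card C = p1 - 2" "card B2 = p2 + 1" "card B3 = p3 + 1" "card B4 = p4 + 1"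
    "card I = n + 3 - (4 + (p1 + p2 + p3 + p4))"
    by (simp_all add: defs card_image inj_on_def)
  have "card (C \<union> B2 \<union> B3 \<union> B4 \<union> I) = card C + card B2 + card B3 + card B4 + card I"
    using fin disj by (simp add: card_Un_disjoint Int_Un_distrib2)
  \<comment> \<open>The first four parts have one vertex more than \<open>p1 + p2 + p3 + p4\<close>,
    so \<open>n\<close> above that sum keeps the subtraction in \<open>card I\<close> exact.\<close>
  also have "\<dots> = n" using p n by (simp add: cards)
  finally have "core_structure (C \<union> B2 \<union> B3 \<union> B4 \<union> I) C B2 B3 B4 p1 p2 p3 p4 n"
    using fin disj cards p by unfold_locales auto
  moreover have "H_graph n [p1, p2, p3, p4] = core_graph (C \<union> B2 \<union> B3 \<union> B4 \<union> I) C B2 B3 B4"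
    unfolding defs by (rule H_graph_eq_core_graph)
  ultimately show ?thesis by blast
qed

text \<open>\<open>sat\<close> minimises over graphs on natural numbers, while
  \<open>H_graph\<close> has tagged vertices; consecutive intervals give the copy that attains the
  minimum.\<close>

lemma core_structure_nat:
  fixes p1 p2 p3 p4 n :: nat
  assumes p: "2 \<le> p1" "p1 \<le> p2" "p2 + p1 \<le> p3" "p3 + p1 \<le> p4" and n: "p1 + p2 + p3 + p4 < n"
  shows "core_structure {..<n} {..<p1 - 2} {p1 - 2..<p1 + p2 - 1} {p1 + p2 - 1..<p1 + p2 + p3}
    {p1 + p2 + p3..<p1 + p2 + p3 + p4 + 1} p1 p2 p3 p4 n"
  using p n by unfold_locales auto

text \<open>The term \<open>(p1 - 2) choose 2\<close> counts the edges inside the joined clique. It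
  is positive for \<open>4 \<le> p1\<close>, and the closed formula in the English text omits
  it.\<close>

theorem theorem1p2:
  fixes p1 p2 p3 p4 n :: nat
  assumes "4 \<le> p1" and "p1 \<le> p2"
    and "p3 \<ge> p2 + p1" and "p4 \<ge> p3 + p1"
    and "n > 3 * (p1 - 2) + (\<Sum>p\<leftarrow>[p2, p3, p4]. p * (p + 1))"
  shows "sat n (clique_union [p1, p2, p3, p4]) = num_edges (H_graph n [p1, p2, p3, p4])
    \<and> num_edges (H_graph n [p1, p2, p3, p4])
        = (p1 - 2) * (n - p1 + 2) + ((p1 - 2) choose 2)
          + (\<Sum>p\<leftarrow>[p2, p3, p4]. (p + 1) choose 2)
    \<and> extremal_graph n (clique_union [p1, p2, p3, p4]) (H_graph n [p1, p2, p3, p4])"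
proof -
  have n: "3 * (p1 - 2) + (p2 * (p2 + 1) + p3 * (p3 + 1) + p4 * (p4 + 1)) < n"
    using assms(5) by (simp add: add.assoc)
  have p: "2 \<le> p1" "p1 \<le> p2" "p2 + p1 \<le> p3" "p3 + p1 \<le> p4" using assms by auto
  \<comment> \<open>Turns the quadratic bound on \<open>n\<close> into the linear one that makes the
    edgeless part of \<open>H_graph\<close> well defined.\<close>
  have "2 * k \<le> k * (k + 1)" if "4 \<le> k" for k :: nat
    using that mult_le_mono2[of 2 "k + 1" k] by (simp add: mult.commute)
  from this[of p2] this[of p3] this[of p4] have big: "p1 + p2 + p3 + p4 < n"
    using n assms(1-4) by linarith
  define m where "m = (p1 - 2) * (n - (p1 - 2)) + ((p1 - 2) choose 2)
      + (((p2 + 1) choose 2) + ((p3 + 1) choose 2) + ((p4 + 1) choose 2))"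
  let ?F = "clique_union [p1, p2, p3, p4]" and ?H = "H_graph n [p1, p2, p3, p4]"
  obtain V C B2 B3 B4 where H: "core_structure V C B2 B3 B4 p1 p2 p3 p4 n"
    "?H = core_graph V C B2 B3 B4"
    using core_structure_H_graph[OF p big] by blast
  have H_sat: "saturated ?F ?H" "num_edges ?H = m" "card (verts ?H) = n"
    using core_structure.saturated_G[OF H(1)] core_structure.num_edges_G[OF H(1)]
      core_structure.verts_G[OF H(1)] core_structure.cards(1)[OF H(1)]
    by (simp_all add: H(2) m_def)
  have sat: "sat n ?F = m"
    unfolding sat_def
  proof (rule Least_equality)
    note N = core_structure_nat[OF p big]
    show "\<exists>G :: nat graph. card (verts G) = n \<and> saturated ?F G \<and> num_edges G = m"
      using core_structure.saturated_G[OF N] core_structure.num_edges_G[OF N]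
        core_structure.verts_G[OF N] core_structure.cards(1)[OF N]
      unfolding m_def by metis
    show "m \<le> k" if "\<exists>G :: nat graph. card (verts G) = n \<and> saturated ?F G \<and> num_edges G = k" for k
      using that saturated_edges_ge[OF assms(1) p(2-4) n] unfolding m_def by blast
  qed
  \<comment> \<open>Holds for natural subtraction because \<open>2 \<le> p1\<close> and
    \<open>p1 < n\<close>.\<close>
  have "n - p1 + 2 = n - (p1 - 2)" using p big by simp
  then have "m = (p1 - 2) * (n - p1 + 2) + ((p1 - 2) choose 2) + (\<Sum>p\<leftarrow>[p2, p3, p4]. (p + 1) choose 2)"
    by (simp add: m_def)
  with H_sat sat show ?thesis by (simp add: extremal_graph_def)
qed

end
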